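(* Let $\mathcal{X},\mathcal{Y}$ be Hilbert modules over a pro-$C^*$-algebra $\mathcal{A}$ and let $T\in Hom^*_{\mathcal{A}}(\mathcal{X},\mathcal{Y})$. Then the following are equivalent: (1) $T$ has a bounded generalized inverse module map $T^\dagger\in Hom^*_{\mathcal{A}}(\mathcal{Y},\mathcal{X})$; (2) $Ran(T)$ is a closed submodule of $\mathcal{Y}$.
   Context: A pro-$C^*$-algebra $\mathcal{A}$ is a complete Hausdorff topological $*$-algebra whose topology is given by its continuous $C^*$-seminorms $S(\mathcal{A})$. A Hilbert $\mathcal{A}$-module is a left $\mathcal{A}$-module with an $\mathcal{A}$-valued inner product, complete for the seminorms $\bar p(\xi)=\sqrt{p(\langle\xi,\xi\rangle)}$, $p\in S(\mathcal{A})$. $Hom^*_{\mathcal{A}}(\mathcal{X},\mathcal{Y})$ denotes the adjointable bounded $\mathcal{A}$-module maps $\mathcal{X}\to\mathcal{Y}$. A bounded generalized inverse module map of $T$ is an operator $T^\dagger\in Hom^*_{\mathcal{A}}(\mathcal{Y},\mathcal{X})$ such that $TT^\dagger T=T$, $T^\dagger TT^\dagger=T^\dagger$, $(TT^\dagger)^*=TT^\dagger$ and $(T^\dagger T)^*=T^\dagger T$. *)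

theory Defs
  imports Complex_Main
begin

text \<open>The underlying ring of the algebra is the type 'a (class ring: associative,
  distributive, not necessarily unital). Complex scalar multiplication, the
  involution and the family S(A) of continuous C*-seminorms are bundled.\<close>

record 'a pro_alg =
  smulA :: "complex \<Rightarrow> 'a \<Rightarrow> 'a"
  star  :: "'a \<Rightarrow> 'a"
  sn    :: "('a \<Rightarrow> real) set"

definition star_algebra :: "'a::ring pro_alg \<Rightarrow> bool" where
  "star_algebra A \<longleftrightarrow>
     (\<forall>c x y. smulA A c (x + y) = smulA A c x + smulA A c y) \<and>
     (\<forall>c d x. smulA A (c + d) x = smulA A c x + smulA A d x) \<and>
     (\<forall>c d x. smulA A (c * d) x = smulA A c (smulA A d x)) \<and>
     (\<forall>x. smulA A 1 x = x) \<and>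
     (\<forall>c x y. smulA A c (x * y) = smulA A c x * y) \<and>
     (\<forall>c x y. smulA A c (x * y) = x * smulA A c y) \<and>
     (\<forall>x y. star A (x + y) = star A x + star A y) \<and>
     (\<forall>c x. star A (smulA A c x) = smulA A (cnj c) (star A x)) \<and>
     (\<forall>x y. star A (x * y) = star A y * star A x) \<and>
     (\<forall>x. star A (star A x) = x)"

definition cstar_seminorm :: "'a::ring pro_alg \<Rightarrow> ('a \<Rightarrow> real) \<Rightarrow> bool" where
  "cstar_seminorm A p \<longleftrightarrow>
     (\<forall>x. 0 \<le> p x) \<and>
     (\<forall>x y. p (x + y) \<le> p x + p y) \<and>
     (\<forall>c x. p (smulA A c x) = cmod c * p x) \<and>
     (\<forall>x y. p (x * y) \<le> p x * p y) \<and>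
     (\<forall>x. p (star A x * x) = (p x)\<^sup>2)"

text \<open>A seminorm q is continuous for the locally convex topology generated by
  the family N iff it is dominated by a multiple of finitely many members of N.\<close>
definition sn_continuous :: "('b \<Rightarrow> real) set \<Rightarrow> ('b \<Rightarrow> real) \<Rightarrow> bool" where
  "sn_continuous N q \<longleftrightarrow>
     (\<exists>G C. G \<subseteq> N \<and> finite G \<and> (\<forall>x. q x \<le> C * (\<Sum>p\<in>G. p x)))"

definition sn_cauchy :: "('b::ab_group_add \<Rightarrow> real) set \<Rightarrow> 'b filter \<Rightarrow> bool" where
  "sn_cauchy N F \<longleftrightarrow>
     (\<forall>p\<in>N. \<forall>e>0. eventually (\<lambda>(x, y). p (x - y) < e) (F \<times>\<^sub>F F))"

definition sn_converges :: "('b::ab_group_add \<Rightarrow> real) set \<Rightarrow> 'b filter \<Rightarrow> 'b \<Rightarrow> bool" where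
  "sn_converges N F x \<longleftrightarrow> (\<forall>p\<in>N. \<forall>e>0. eventually (\<lambda>y. p (y - x) < e) F)"

definition sn_complete :: "('b::ab_group_add \<Rightarrow> real) set \<Rightarrow> bool" where
  "sn_complete N \<longleftrightarrow>
     (\<forall>F. F \<noteq> bot \<and> sn_cauchy N F \<longrightarrow> (\<exists>x. sn_converges N F x))"

definition sn_hausdorff :: "('b::ab_group_add \<Rightarrow> real) set \<Rightarrow> bool" where
  "sn_hausdorff N \<longleftrightarrow> (\<forall>x. (\<forall>p\<in>N. p x = 0) \<longrightarrow> x = 0)"

text \<open>Closed sets: a set containing all its adherent points, where basic
  neighbourhoods of x are given by finitely many seminorms and a radius.\<close>
definition sn_closed :: "('b::ab_group_add \<Rightarrow> real) set \<Rightarrow> 'b set \<Rightarrow> bool" where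
  "sn_closed N C \<longleftrightarrow>
     (\<forall>x. (\<forall>G. G \<subseteq> N \<and> finite G \<longrightarrow> (\<forall>e>0. \<exists>c\<in>C. \<forall>p\<in>G. p (x - c) < e))
          \<longrightarrow> x \<in> C)"

text \<open>A pro-C*-algebra: complete Hausdorff topological *-algebra whose topology is
  given by the family sn A, which is exactly the set of all continuous
  C*-seminorms S(A).\<close>
definition pro_cstar_algebra :: "'a::ring pro_alg \<Rightarrow> bool" where
  "pro_cstar_algebra A \<longleftrightarrow>
     star_algebra A \<and>
     (\<forall>p\<in>sn A. cstar_seminorm A p) \<and>
     (\<forall>q. cstar_seminorm A q \<and> sn_continuous (sn A) q \<longrightarrow> q \<in> sn A) \<and>
     sn_hausdorff (sn A) \<and>
     sn_complete (sn A)"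

definition positive :: "'a::ring pro_alg \<Rightarrow> 'a \<Rightarrow> bool" where
  "positive A a \<longleftrightarrow> (\<exists>b. a = star A b * b)"

record ('a, 'x) hmod =
  smulX :: "complex \<Rightarrow> 'x \<Rightarrow> 'x"
  act   :: "'a \<Rightarrow> 'x \<Rightarrow> 'x"
  ip    :: "'x \<Rightarrow> 'x \<Rightarrow> 'a"

definition hm_norms :: "'a::ring pro_alg \<Rightarrow> ('a, 'x) hmod \<Rightarrow> ('x \<Rightarrow> real) set" where
  "hm_norms A X = {(\<lambda>\<xi>. sqrt (p (ip X \<xi> \<xi>))) | p. p \<in> sn A}"

definition hilbert_module :: "'a::ring pro_alg \<Rightarrow> ('a, 'x::ab_group_add) hmod \<Rightarrow> bool" where
  "hilbert_module A X \<longleftrightarrow>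
     (\<forall>c x y. smulX X c (x + y) = smulX X c x + smulX X c y) \<and>
     (\<forall>c d x. smulX X (c + d) x = smulX X c x + smulX X d x) \<and>
     (\<forall>c d x. smulX X (c * d) x = smulX X c (smulX X d x)) \<and>
     (\<forall>x. smulX X 1 x = x) \<and>
     (\<forall>a x y. act X a (x + y) = act X a x + act X a y) \<and>
     (\<forall>a b x. act X (a + b) x = act X a x + act X b x) \<and>
     (\<forall>a b x. act X (a * b) x = act X a (act X b x)) \<and>
     (\<forall>c a x. smulX X c (act X a x) = act X (smulA A c a) x) \<and>
     (\<forall>c a x. smulX X c (act X a x) = act X a (smulX X c x)) \<and>
     (\<forall>x y z. ip X (x + y) z = ip X x z + ip X y z) \<and>
     (\<forall>c x y. ip X (smulX X c x) y = smulA A c (ip X x y)) \<and>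
     (\<forall>a x y. ip X (act X a x) y = a * ip X x y) \<and>
     (\<forall>x y. star A (ip X x y) = ip X y x) \<and>
     (\<forall>x. positive A (ip X x x)) \<and>
     (\<forall>x. ip X x x = 0 \<longrightarrow> x = 0) \<and>
     sn_complete (hm_norms A X)"

definition module_map ::
  "('a, 'x::ab_group_add) hmod \<Rightarrow> ('a, 'y::ab_group_add) hmod \<Rightarrow> ('x \<Rightarrow> 'y) \<Rightarrow> bool" where
  "module_map X Y T \<longleftrightarrow>
     (\<forall>x y. T (x + y) = T x + T y) \<and>
     (\<forall>c x. T (smulX X c x) = smulX Y c (T x)) \<and>
     (\<forall>a x. T (act X a x) = act Y a (T x))"

definition bounded_map ::
  "'a::ring pro_alg \<Rightarrow> ('a, 'x) hmod \<Rightarrow> ('a, 'y) hmod \<Rightarrow> ('x \<Rightarrow> 'y) \<Rightarrow> bool" where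
  "bounded_map A X Y T \<longleftrightarrow>
     (\<forall>p\<in>sn A. \<exists>k. \<forall>x. sqrt (p (ip Y (T x) (T x))) \<le> k * sqrt (p (ip X x x)))"

definition is_adjoint ::
  "('a, 'x) hmod \<Rightarrow> ('a, 'y) hmod \<Rightarrow> ('x \<Rightarrow> 'y) \<Rightarrow> ('y \<Rightarrow> 'x) \<Rightarrow> bool" where
  "is_adjoint X Y T S \<longleftrightarrow> (\<forall>x y. ip Y (T x) y = ip X x (S y))"

definition Hom_star ::
  "'a::ring pro_alg \<Rightarrow> ('a, 'x::ab_group_add) hmod \<Rightarrow> ('a, 'y::ab_group_add) hmod \<Rightarrow> ('x \<Rightarrow> 'y) set" where
  "Hom_star A X Y = {T. module_map X Y T \<and> bounded_map A X Y T \<and> (\<exists>S. is_adjoint X Y T S)}"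

text \<open>Bounded generalized inverse module map (Moore-Penrose conditions).
  \<open>(T T\<^sup>\<dagger>)\<^sup>* = T T\<^sup>\<dagger>\<close> is expressed as: \<open>T T\<^sup>\<dagger>\<close> is an adjoint of itself.\<close>
definition gen_inverse ::
  "'a::ring pro_alg \<Rightarrow> ('a, 'x::ab_group_add) hmod \<Rightarrow> ('a, 'y::ab_group_add) hmod
     \<Rightarrow> ('x \<Rightarrow> 'y) \<Rightarrow> ('y \<Rightarrow> 'x) \<Rightarrow> bool" where
  "gen_inverse A X Y T Td \<longleftrightarrow>
     Td \<in> Hom_star A Y X \<and>
     T \<circ> Td \<circ> T = T \<and>
     Td \<circ> T \<circ> Td = Td \<and>
     is_adjoint Y Y (T \<circ> Td) (T \<circ> Td) \<and>
     is_adjoint X X (Td \<circ> T) (Td \<circ> T)"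

definition submodule :: "('a, 'x::ab_group_add) hmod \<Rightarrow> 'x set \<Rightarrow> bool" where
  "submodule X M \<longleftrightarrow> 0 \<in> M \<and> (\<forall>x\<in>M. \<forall>y\<in>M. x + y \<in> M) \<and>
     (\<forall>c. \<forall>x\<in>M. smulX X c x \<in> M) \<and> (\<forall>a. \<forall>x\<in>M. act X a x \<in> M)"

end

theory Submission
  imports Defs "HOL-Computational_Algebra.Polynomial"
begin

text \<open>The work is in showing that a closed range \<open>R\<close> yields a generalized inverse. The seminorms
  \<open>p(\<langle>x, x\<rangle>)\<^bsup>1/2\<^esup>\<close> satisfy Cauchy--Schwarz because C*-seminorms are monotone on elements
  \<open>b\<^sup>*b\<close>; this is derived for a single seminorm on a possibly incomplete algebra, replacing the
  functional calculus by polynomials in one self-adjoint element.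

  No open mapping theorem holds for a general family of seminorms. But every \<open>w \<in> R\<close> has, for
  given \<open>p\<close>, a truncation \<open>c(c + \<langle>w, w\<rangle>)\<^sup>-\<^sup>1w \<in> R\<close> that is bounded in all seminorms at once by the
  \<open>p\<close>-norm of \<open>w\<close>. A gliding hump built from truncations shows that \<open>T\<^sup>*\<close> is bounded below on
  \<open>R\<close> for each \<open>p\<close>. Hence \<open>TT\<^sup>*\<close> is bounded below on \<open>R\<close>; approximate solutions for the
  individual \<open>p\<close> form a Cauchy filter, so \<open>TT\<^sup>*\<close> restricts to a bijection of \<open>R\<close> with inverse \<open>G\<close>,
  and \<open>T\<^sup>\<dagger> = T\<^sup>*GGTT\<^sup>*\<close>.\<close>

section \<open>Polynomial seminorms\<close>

text \<open>The quotient of the algebra by the kernel of one seminorm need not have a unit and is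
  not assumed complete, so spectra, square roots and inverses are not at hand there. They are
  replaced by a seminorm on \<open>real poly\<close>: substituting a self-adjoint operator for the
  variable supplies commutativity and a unit, and a few axioms already yield an order. This
  abstraction serves twice, for left multiplications on the algebra and for module operators
  restricted to the range. Two obstacles shape the rest. The family of seminorms may be uncountable,
  so no Baire argument applies; a hump built for one \<open>p\<close> must still converge for every
  seminorm, and vectors controlled by \<open>p\<close> alone would not do. Moreover no complement of
  the range is known beforehand, so \<open>D = T S\<close>, with \<open>S\<close> the adjoint of
  \<open>T\<close>, is inverted only on the range; the projection onto the range is then obtained as
  \<open>P = G D\<close>.\<close>

lemma le_of_le_add_mult_eps:
  fixes a b c :: real
  assumes "\<And>e. 0 < e \<Longrightarrow> e \<le> 1 \<Longrightarrow> a \<le> b + c * e" "0 \<le> c"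
  shows "a \<le> b"
proof (rule ccontr)
  assume "\<not> a \<le> b"
  define e where "e = min 1 ((a - b) / (2 * (c + 1)))"
  have "0 < e" "e \<le> 1" using \<open>\<not> a \<le> b\<close> assms(2) by (auto simp: e_def)
  then have "a \<le> b + c * e" by (rule assms(1))
  moreover have "c * e \<le> (c + 1) * ((a - b) / (2 * (c + 1)))"
    using assms(2) \<open>0 < e\<close> by (intro mult_mono) (auto simp: e_def)
  moreover have "(c + 1) * ((a - b) / (2 * (c + 1))) = (a - b) / 2"
    using assms(2) by (simp add: field_simps)
  ultimately have "a \<le> b + (a - b) / 2" by linarith
  then show False using \<open>\<not> a \<le> b\<close> by (simp add: field_simps)
qed

lemma real_poly_ext: "(\<And>x::real. poly P x = poly Q x) \<Longrightarrow> P = Q"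
  using poly_eq_poly_eq_iff[of P Q] by (simp add: fun_eq_iff)

text \<open>\<open>square_le\<close> is the trace that the C*-identity for \<open>P + \<i> Q\<close>
  leaves in a real algebra: the squared norm is that of \<open>P\<^sup>2 + Q\<^sup>2\<close>, and
  \<open>P\<close> is the real part. \<open>one_le\<close> is an inequality because
  \<open>\<nu>\<close> may vanish identically.\<close>

locale real_cstar_seminorm =
  fixes \<nu> :: "real poly \<Rightarrow> real"
  assumes nonneg [simp]: "0 \<le> \<nu> P"
    and add_le: "\<nu> (P + Q) \<le> \<nu> P + \<nu> Q"
    and mult_le: "\<nu> (P * Q) \<le> \<nu> P * \<nu> Q"
    and smult_le: "\<nu> (smult c P) \<le> \<bar>c\<bar> * \<nu> P"
    and one_le: "\<nu> 1 \<le> 1"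
    and square_le: "(\<nu> P)\<^sup>2 \<le> \<nu> (P\<^sup>2 + Q\<^sup>2)"
begin

lemma const_le: "\<nu> [:c:] \<le> \<bar>c\<bar>"
proof -
  have "\<nu> (smult c 1) \<le> \<bar>c\<bar> * \<nu> 1" by (rule smult_le)
  also have "\<dots> \<le> \<bar>c\<bar> * 1" by (intro mult_left_mono one_le) auto
  finally show ?thesis by simp
qed

lemma zero [simp]: "\<nu> 0 = 0"
  using const_le[of 0] by (simp add: antisym)

lemma minus: "\<nu> (- P) = \<nu> P"
  using smult_le[of "-1" P] smult_le[of "-1" "- P"] by simp

lemma minus_commute: "\<nu> (P - Q) = \<nu> (Q - P)"
  using minus[of "P - Q"] by simp

lemma diff_le: "\<nu> (P - Q) \<le> \<nu> P + \<nu> Q"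
  using add_le[of P "- Q"] by (simp add: minus)

lemma le_diff: "\<nu> P \<le> \<nu> Q + \<nu> (P - Q)"
  using add_le[of Q "P - Q"] by simp

lemma square: "\<nu> (P\<^sup>2) = (\<nu> P)\<^sup>2"
  using square_le[of P 0] mult_le[of P P] by (simp add: power2_eq_square)

lemma power_le: "\<nu> (P ^ n) \<le> \<nu> P ^ n"
proof (induction n)
  case (Suc n)
  have "\<nu> (P ^ Suc n) \<le> \<nu> P * \<nu> (P ^ n)" using mult_le by simp
  also have "\<dots> \<le> \<nu> P * \<nu> P ^ n" by (intro mult_left_mono Suc) auto
  finally show ?case by simp
qed (simp add: one_le)

lemma power_two_power: "\<nu> (P ^ (2 ^ k)) = \<nu> P ^ (2 ^ k)"
proof (induction k)
  case (Suc k)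
  have "P ^ (2 ^ Suc k) = (P ^ (2 ^ k))\<^sup>2" by (simp add: power_mult [symmetric] mult.commute)
  then have "\<nu> (P ^ (2 ^ Suc k)) = (\<nu> P ^ (2 ^ k))\<^sup>2" by (simp only: square Suc)
  then show ?case by (simp add: power_mult [symmetric] mult.commute)
qed simp

text \<open>The C*-identity only reaches exponents that are powers of two. With
  \<open>2 ^ n = n + m\<close>, a loss at exponent \<open>n\<close> would persist at
  \<open>2 ^ n\<close> after multiplication by \<open>P ^ m\<close>.\<close>

lemma power:
  assumes "0 < n"
  shows "\<nu> (P ^ n) = \<nu> P ^ n"
proof (cases "\<nu> P = 0")
  case True
  then show ?thesis using power_le[of P n] nonneg[of "P ^ n"] assms by (simp del: nonneg add: zero_power)
next
  case False
  have "n \<le> 2 ^ n" by (simp add: less_imp_le)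
  then obtain m where m: "2 ^ n = n + m" using le_Suc_ex by blast
  have "\<nu> P ^ n * \<nu> P ^ m = \<nu> (P ^ n * P ^ m)"
    using power_two_power[of P n] by (simp add: m power_add)
  also have "\<dots> \<le> \<nu> (P ^ n) * \<nu> P ^ m"
    by (rule order_trans[OF mult_le]) (intro mult_left_mono power_le nonneg)
  finally have "\<nu> P ^ n * \<nu> P ^ m \<le> \<nu> (P ^ n) * \<nu> P ^ m" .
  moreover have "0 < \<nu> P" using False nonneg[of P] by linarith
  ultimately have "\<nu> P ^ n \<le> \<nu> (P ^ n)" by simp
  then show ?thesis using power_le by (simp add: antisym)
qed

text \<open>In a C*-algebra this says that the spectrum lies in \<open>[0, 2 t]\<close>. The form
  needs no spectrum and makes sums easy.\<close>

definition pos :: "real poly \<Rightarrow> bool" where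
  "pos P \<longleftrightarrow> (\<exists>t\<ge>0. \<nu> ([:t:] - P) \<le> t)"

lemma posI: "0 \<le> t \<Longrightarrow> \<nu> ([:t:] - P) \<le> t \<Longrightarrow> pos P"
  by (auto simp: pos_def)

lemma pos_add: assumes "pos P" "pos Q" shows "pos (P + Q)"
proof -
  obtain t where t: "t \<ge> 0" "\<nu> ([:t:] - P) \<le> t" using assms by (auto simp: pos_def)
  obtain s where s: "s \<ge> 0" "\<nu> ([:s:] - Q) \<le> s" using assms by (auto simp: pos_def)
  have "[:t + s:] - (P + Q) = ([:t:] - P) + ([:s:] - Q)" by (rule real_poly_ext) simp
  then have "\<nu> ([:t + s:] - (P + Q)) \<le> t + s"
    using add_le[of "[:t:] - P" "[:s:] - Q"] t(2) s(2) by (metis add_mono order_trans)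
  then show ?thesis using t s by (intro posI[of "t + s"]) auto
qed

lemma pos_const_diff: "\<nu> P \<le> s \<Longrightarrow> pos ([:s:] - P)"
  using nonneg[of P] by (intro posI[of s]) (auto intro: order_trans[OF nonneg])

lemma pos_const_add: "\<nu> P \<le> s \<Longrightarrow> pos ([:s:] + P)"
  using pos_const_diff[of "- P" s] by (simp add: minus)

lemma pos_const: "0 \<le> c \<Longrightarrow> pos [:c:]"
  using pos_const_diff[of 0 c] by simp

lemma pos_smult: assumes "pos P" "0 \<le> c" shows "pos (smult c P)"
proof -
  obtain t where t: "t \<ge> 0" "\<nu> ([:t:] - P) \<le> t" using assms by (auto simp: pos_def)
  have "[:c * t:] - smult c P = smult c ([:t:] - P)" by (rule real_poly_ext) (simp add: algebra_simps)
  then have "\<nu> ([:c * t:] - smult c P) \<le> c * t"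
    using smult_le[of c "[:t:] - P"] mult_left_mono[OF t(2) assms(2)] assms(2) by simp
  then show ?thesis using t assms by (intro posI[of "c * t"]) auto
qed

text \<open>The iteration \<open>u := (x + u^2) / 2\<close> has the fixed point
  \<open>1 - sqrt (1 - x)\<close>. It contracts with factor \<open>s\<close> on the ball of radius
  \<open>s\<close> and stays among polynomials; in the absence of completeness it is stopped at a
  finite stage.\<close>

lemma approx_sqrt_one_minus:
  assumes x: "\<nu> x \<le> s" and s: "s < 1" and e: "0 < e"
  shows "\<exists>r. \<nu> (r\<^sup>2 - (1 - x)) \<le> e"
proof -
  have s0: "0 \<le> s" using x nonneg[of x] by linarith
  define u where "u = rec_nat (0::real poly) (\<lambda>_ u. smult (1/2) (x + u\<^sup>2))"
  have u0: "u 0 = 0" and uS: "u (Suc k) = smult (1/2) (x + (u k)\<^sup>2)" for k by (simp_all add: u_def)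
  have ub: "\<nu> (u k) \<le> s" for k
  proof (induction k)
    case (Suc k)
    have "\<nu> (u (Suc k)) \<le> (1/2) * \<nu> (x + (u k)\<^sup>2)" unfolding uS using smult_le[of "1/2"] by simp
    also have "\<nu> (x + (u k)\<^sup>2) \<le> s + s\<^sup>2"
      using Suc x by (intro order_trans[OF add_le] add_mono) (auto simp: square power_mono)
    also have "1/2 * (s + s\<^sup>2) \<le> s"
      using mult_left_mono[of s 1 s] s s0 by (simp add: power2_eq_square)
    finally show ?case by simp
  qed (simp add: u0 s0)
  have ud: "\<nu> (u (Suc k) - u k) \<le> s ^ Suc k" for k
  proof (induction k)
    case 0
    have "\<nu> (u (Suc 0) - u 0) \<le> (1/2) * \<nu> x" using smult_le[of "1/2" x] by (simp add: uS u0)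
    also have "\<dots> \<le> s" using x nonneg[of x] by linarith
    finally show ?case by simp
  next
    case (Suc k)
    have "u (Suc (Suc k)) - u (Suc k) = smult (1/2) ((u (Suc k) + u k) * (u (Suc k) - u k))"
      unfolding uS[of "Suc k"] uS[of k]
      by (rule real_poly_ext) (simp add: algebra_simps power2_eq_square)
    then have "\<nu> (u (Suc (Suc k)) - u (Suc k)) \<le> (1/2) * (\<nu> (u (Suc k) + u k) * \<nu> (u (Suc k) - u k))"
      using smult_le[of "1/2" "(u (Suc k) + u k) * (u (Suc k) - u k)"]
        mult_le[of "u (Suc k) + u k" "u (Suc k) - u k"] by simp
    also have "\<dots> \<le> (1/2) * ((s + s) * s ^ Suc k)"
      using add_le[of "u (Suc k)" "u k"] ub[of k] ub[of "Suc k"] Suc s0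
      by (intro mult_left_mono mult_mono) auto
    finally show ?case by simp
  qed
  have "(\<lambda>k. 2 * s ^ Suc k) \<longlonglongrightarrow> 2 * (s * 0)"
    using s s0 by (simp add: LIMSEQ_power_zero tendsto_mult_right_zero)
  then have "eventually (\<lambda>k. 2 * s ^ Suc k < e) sequentially"
    using e by (intro order_tendstoD) auto
  then obtain k where k: "2 * s ^ Suc k < e" by (auto simp: eventually_sequentially)
  \<comment> \<open>The defect of the approximate root is twice the next increment of the
    iteration.\<close>
  have "(1 - u k)\<^sup>2 - (1 - x) = smult 2 (u (Suc k) - u k)"
    unfolding uS by (rule real_poly_ext) (simp add: algebra_simps power2_eq_square)
  then have "\<nu> ((1 - u k)\<^sup>2 - (1 - x)) \<le> 2 * s ^ Suc k"
    using smult_le[of 2 "u (Suc k) - u k"] ud[of k] by simp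
  then show ?thesis using k by (intro exI[of _ "1 - u k"]) simp
qed

text \<open>If \<open>r\<^sup>2 = 1 - b\<^sup>2\<close>, then \<open>r + \<i>b\<close> is unitary; this is why \<open>square_le\<close> gives \<open>\<nu> r \<le> 1\<close>.\<close>

lemma one_minus_square_le:
  assumes b: "\<nu> b \<le> 1"
  shows "\<nu> (1 - b\<^sup>2) \<le> 1"
proof -
  have b2: "\<nu> (b\<^sup>2) \<le> 1" using b by (simp add: square power_le_one)
  \<comment> \<open>The square root iteration needs norm strictly below \<open>1\<close>, so
    \<open>b\<close> is first shrunk by \<open>s < 1\<close>; afterwards \<open>s\<close> tends to
    \<open>1\<close>.\<close>
  have scaled: "\<nu> (1 - (smult s b)\<^sup>2) \<le> 1" if s: "0 \<le> s" "s < 1" for s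
  proof (rule le_of_le_add_mult_eps[where c = 2])
    fix e :: real assume e: "0 < e" "e \<le> 1"
    have "\<nu> (smult s b) \<le> s * 1"
      using smult_le[of s b] mult_left_mono[OF b s(1)] s(1) by simp
    then have sb: "\<nu> ((smult s b)\<^sup>2) \<le> s\<^sup>2" by (simp add: square power_mono)
    have "s\<^sup>2 < 1" using s by (simp add: power_less_one_iff abs_square_less_1)
    then obtain r where r: "\<nu> (r\<^sup>2 - (1 - (smult s b)\<^sup>2)) \<le> e"
      using approx_sqrt_one_minus[OF sb _ e(1)] by blast
    have "(\<nu> r)\<^sup>2 \<le> \<nu> (r\<^sup>2 + (smult s b)\<^sup>2)" by (rule square_le)
    also have "\<dots> \<le> \<nu> 1 + \<nu> (r\<^sup>2 + (smult s b)\<^sup>2 - 1)" by (rule le_diff)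
    also have "\<dots> \<le> 1 + e" using r one_le by (simp add: algebra_simps)
    finally have "\<nu> (r\<^sup>2) \<le> 1 + e" by (simp add: square)
    then show "\<nu> (1 - (smult s b)\<^sup>2) \<le> 1 + 2 * e"
      using le_diff[of "1 - (smult s b)\<^sup>2" "r\<^sup>2"] r minus_commute[of "r\<^sup>2"] by simp
  qed simp
  show ?thesis
  proof (rule le_of_le_add_mult_eps[where c = 2])
    fix e :: real assume e: "0 < e" "e \<le> 1"
    define s where "s = 1 - e"
    have s: "0 \<le> s" "s < 1" using e by (auto simp: s_def)
    have "(1 - b\<^sup>2) - (1 - (smult s b)\<^sup>2) = smult (s\<^sup>2 - 1) (b\<^sup>2)"
      by (rule real_poly_ext) (simp add: algebra_simps power2_eq_square)
    then have "\<nu> ((1 - b\<^sup>2) - (1 - (smult s b)\<^sup>2)) \<le> \<bar>s\<^sup>2 - 1\<bar> * 1"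
      using smult_le[of "s\<^sup>2 - 1" "b\<^sup>2"] mult_left_mono[OF b2, of "\<bar>s\<^sup>2 - 1\<bar>"] by simp
    also have "\<bar>s\<^sup>2 - 1\<bar> \<le> 2 * e"
    proof -
      have "s\<^sup>2 - 1 = e * e - 2 * e" by (simp add: s_def power2_eq_square algebra_simps)
      moreover have "e * e \<le> e" using mult_left_mono[of e 1 e] e by simp
      moreover have "0 \<le> e * e" by simp
      ultimately show ?thesis using e by linarith
    qed
    finally show "\<nu> (1 - b\<^sup>2) \<le> 1 + 2 * e"
      using le_diff[of "1 - b\<^sup>2" "1 - (smult s b)\<^sup>2"] scaled[OF s] by simp
  qed simp
qed

lemma const_minus_square_le:
  assumes "(\<nu> r)\<^sup>2 \<le> t" "0 < t"
  shows "\<nu> ([:t:] - r\<^sup>2) \<le> t"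
proof -
  define b where "b = smult (1 / sqrt t) r"
  have "\<nu> r \<le> sqrt t" using assms by (simp add: real_le_rsqrt)
  then have "\<nu> r / sqrt t \<le> 1" using assms(2) by simp
  then have "\<nu> b \<le> 1"
    using smult_le[of "1 / sqrt t" r] assms(2) unfolding b_def by (auto intro: order_trans)
  then have "\<nu> (1 - b\<^sup>2) \<le> 1" by (rule one_minus_square_le)
  moreover have "[:t:] - r\<^sup>2 = smult t (1 - b\<^sup>2)"
    unfolding b_def using assms(2)
    by (intro real_poly_ext) (simp add: field_simps)
  ultimately show ?thesis using smult_le[of t "1 - b\<^sup>2"] assms(2)
    by (simp add: mult_left_le order_trans)
qed

text \<open>Sums are easy in the defining form and products are easy with squares; this is the
  passage between the two. Forwards, \<open>P + d\<close> is a multiple of \<open>1 - x\<close> with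
  the norm of \<open>x\<close> below \<open>1\<close>; backwards,
  \<open>const_minus_square_le\<close> bounds \<open>t - r^2\<close>.\<close>

lemma pos_iff_approx_square: "pos P \<longleftrightarrow> (\<forall>e>0. \<exists>r. \<nu> (r\<^sup>2 - P) \<le> e)"
proof (intro iffI allI impI)
  fix e :: real assume "pos P" and e: "0 < e"
  then obtain t where t: "t \<ge> 0" "\<nu> ([:t:] - P) \<le> t" by (auto simp: pos_def)
  define d where "d = e / 2"
  have d: "0 < d" using e by (simp add: d_def)
  define x where "x = smult (1 / (t + d)) ([:t:] - P)"
  have "\<nu> x \<le> t / (t + d)"
    using smult_le[of "1 / (t + d)" "[:t:] - P"] t d
    by (simp add: x_def divide_right_mono order_trans)
  moreover have "t / (t + d) < 1" "0 < d / (t + d)" using t d by auto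
  ultimately obtain r where r: "\<nu> (r\<^sup>2 - (1 - x)) \<le> d / (t + d)"
    using approx_sqrt_one_minus by blast
  define q where "q = smult (sqrt (t + d)) r"
  have "q\<^sup>2 - P = smult (t + d) (r\<^sup>2 - (1 - x)) + [:d:]"
    unfolding q_def x_def using t d
    by (intro real_poly_ext) (simp add: field_simps power_mult_distrib)
  then have "\<nu> (q\<^sup>2 - P) \<le> \<nu> (smult (t + d) (r\<^sup>2 - (1 - x))) + \<nu> [:d:]"
    using add_le by simp
  also have "\<dots> \<le> (t + d) * (d / (t + d)) + d"
    using smult_le[of "t + d" "r\<^sup>2 - (1 - x)"] mult_left_mono[OF r, of "t + d"] const_le[of d] t d
    by simp
  also have "\<dots> = d + d" using t d by simp
  also have "\<dots> = e" by (simp add: d_def)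
  finally show "\<exists>r. \<nu> (r\<^sup>2 - P) \<le> e" by blast
next
  assume sq: "\<forall>e>0. \<exists>r. \<nu> (r\<^sup>2 - P) \<le> e"
  define t where "t = \<nu> P + 1"
  have t: "0 < t" using nonneg[of P] unfolding t_def by linarith
  have "\<nu> ([:t:] - P) \<le> t"
  proof (rule le_of_le_add_mult_eps[where c = 1])
    fix e :: real assume e: "0 < e" "e \<le> 1"
    obtain r where r: "\<nu> (r\<^sup>2 - P) \<le> e" using sq e by blast
    have "(\<nu> r)\<^sup>2 \<le> t" using le_diff[of "r\<^sup>2" P] r e by (simp add: square t_def)
    then have "\<nu> ([:t:] - r\<^sup>2) \<le> t" using t by (rule const_minus_square_le)
    then show "\<nu> ([:t:] - P) \<le> t + 1 * e"
      using le_diff[of "[:t:] - P" "[:t:] - r\<^sup>2"] r by simp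
  qed simp
  then show "pos P" using t by (intro posI[of t]) auto
qed

lemma pos_square: "pos (P\<^sup>2)"
  unfolding pos_iff_approx_square by (auto intro!: exI[of _ P])

lemma pos_limit: assumes "\<And>e. 0 < e \<Longrightarrow> pos (P + [:e:])" shows "pos P"
  unfolding pos_iff_approx_square
proof (intro allI impI)
  fix e :: real assume e: "0 < e"
  then have "pos (P + [:e/2:])" using assms by simp
  then obtain r where r: "\<nu> (r\<^sup>2 - (P + [:e/2:])) \<le> e / 2"
    using e unfolding pos_iff_approx_square by (meson half_gt_zero)
  have "\<nu> (r\<^sup>2 - P) \<le> \<nu> (r\<^sup>2 - (P + [:e/2:])) + \<nu> [:e/2:]"
    using add_le[of "r\<^sup>2 - (P + [:e/2:])" "[:e/2:]"] by (simp add: algebra_simps)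
  then show "\<exists>r. \<nu> (r\<^sup>2 - P) \<le> e" using r const_le[of "e/2"] e by (intro exI[of _ r]) simp
qed

text \<open>Approximate square roots multiply because polynomials commute.\<close>

lemma pos_mult: assumes "pos P" "pos Q" shows "pos (P * Q)"
  unfolding pos_iff_approx_square
proof (intro allI impI)
  fix e :: real assume e: "0 < e"
  define K where "K = \<nu> P + \<nu> Q + 1"
  have K: "0 < K" using nonneg[of P] nonneg[of Q] unfolding K_def by linarith
  define d where "d = min 1 (e / K)"
  have d: "0 < d" "d \<le> 1" "K * d \<le> e"
    using e K by (auto simp: d_def min_def field_simps)
  obtain r where r: "\<nu> (r\<^sup>2 - P) \<le> d" using assms d unfolding pos_iff_approx_square by blast
  obtain s where s: "\<nu> (s\<^sup>2 - Q) \<le> d" using assms d unfolding pos_iff_approx_square by blast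
  have s1: "\<nu> (s\<^sup>2) \<le> \<nu> Q + 1" using le_diff[of "s\<^sup>2" Q] s d by simp
  have "(r * s)\<^sup>2 - P * Q = (r\<^sup>2 - P) * s\<^sup>2 + P * (s\<^sup>2 - Q)"
    by (simp add: algebra_simps power_mult_distrib)
  then have "\<nu> ((r * s)\<^sup>2 - P * Q) \<le> \<nu> ((r\<^sup>2 - P) * s\<^sup>2) + \<nu> (P * (s\<^sup>2 - Q))" using add_le by simp
  also have "\<dots> \<le> \<nu> (r\<^sup>2 - P) * \<nu> (s\<^sup>2) + \<nu> P * \<nu> (s\<^sup>2 - Q)" by (intro add_mono mult_le)
  also have "\<dots> \<le> d * (\<nu> Q + 1) + \<nu> P * d"
    using r s s1 d by (intro add_mono mult_mono) auto
  also have "\<dots> = K * d" by (simp add: K_def algebra_simps)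
  finally show "\<exists>r. \<nu> (r\<^sup>2 - P * Q) \<le> e" using d by (intro exI[of _ "r * s"]) simp
qed

lemma pos_power: "pos P \<Longrightarrow> pos (P ^ n)"
  by (induction n) (auto intro: pos_mult pos_const[of 1, simplified one_pCons[symmetric]])

lemma pos_sum: "(\<And>i. i \<in> I \<Longrightarrow> pos (f i)) \<Longrightarrow> pos (sum f I)"
  by (induction I rule: infinite_finite_induct) (auto intro: pos_add pos_const[of 0, simplified])

text \<open>If \<open>r^2\<close> is close to \<open>P\<close> and \<open>q^2\<close> to
  \<open>s - P\<close>, then \<open>r^2 + q^2\<close> is close to \<open>s\<close>, and
  \<open>square_le\<close> discards \<open>q\<close>.\<close>

lemma pos_bounded:
  assumes "pos P" "pos ([:s:] - P)" "0 \<le> s"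
  shows "\<nu> P \<le> s"
proof (rule le_of_le_add_mult_eps[where c = 3])
  fix e :: real assume e: "0 < e" "e \<le> 1"
  obtain r where r: "\<nu> (r\<^sup>2 - P) \<le> e" using assms e unfolding pos_iff_approx_square by blast
  obtain q where q: "\<nu> (q\<^sup>2 - ([:s:] - P)) \<le> e" using assms e unfolding pos_iff_approx_square by blast
  have eq: "r\<^sup>2 + q\<^sup>2 = [:s:] + ((r\<^sup>2 - P) + (q\<^sup>2 - ([:s:] - P)))" by simp
  have "\<nu> (r\<^sup>2 + q\<^sup>2) \<le> s + (e + e)" unfolding eq
    using add_le[of "[:s:]" "(r\<^sup>2 - P) + (q\<^sup>2 - ([:s:] - P))"]
      add_le[of "r\<^sup>2 - P" "q\<^sup>2 - ([:s:] - P)"] r q const_le[of s] assms(3) by linarith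
  then have "\<nu> (r\<^sup>2) \<le> s + (e + e)" using square_le[of r q] by (simp add: square)
  then show "\<nu> P \<le> s + 3 * e" using le_diff[of P "r\<^sup>2"] r minus_commute[of P] by simp
qed simp

text \<open>The product \<open>(s - P) (s + P) = s^2 - P^2\<close> reduces a two-sided bound to the
  positive element \<open>P^2\<close>.\<close>

lemma sym_bounded:
  assumes "pos ([:s:] - P)" "pos ([:s:] + P)" "0 \<le> s"
  shows "\<nu> P \<le> s"
proof -
  have "[:s\<^sup>2:] - P\<^sup>2 = ([:s:] - P) * ([:s:] + P)"
    by (rule real_poly_ext) (simp add: algebra_simps power2_eq_square)
  then have "pos ([:s\<^sup>2:] - P\<^sup>2)" using assms pos_mult by simp
  then have "\<nu> (P\<^sup>2) \<le> s\<^sup>2" using pos_square by (intro pos_bounded) auto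
  then show ?thesis using assms(3) by (simp add: square power2_le_iff_abs_le)
qed

text \<open>On \<open>[0, 1]\<close> the function \<open>w^N (1 - w)\<close> is at most the average
  of \<open>w^j (1 - w)\<close> over \<open>j \<le> N\<close>, and the sum of these telescopes to
  \<open>1 - w^(N + 1)\<close>.\<close>

lemma power_mult_one_minus_le:
  assumes W: "pos W" "pos (1 - W)"
  shows "\<nu> (W ^ N * (1 - W)) \<le> 1 / (real N + 1)"
proof -
  define P where "P = smult (real N + 1) (W ^ N * (1 - W))"
  have geo: "(1 - W) * (\<Sum>j<m. W ^ j) = 1 - W ^ m" for m
    by (simp add: one_diff_power_eq)
  have mono: "pos ((W ^ j - W ^ N) * (1 - W))" if "j \<le> N" for j
  proof -
    have "W ^ N = W ^ j * W ^ (N - j)" using that by (simp add: power_add[symmetric])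
    then have "(W ^ j - W ^ N) * (1 - W) = W ^ j * ((1 - W) * (1 - W ^ (N - j)))"
      by (simp only: algebra_simps)
    also have "\<dots> = W ^ j * ((1 - W)\<^sup>2 * (\<Sum>i<N - j. W ^ i))"
      unfolding geo[symmetric] by (simp only: power2_eq_square mult.assoc)
    finally have "(W ^ j - W ^ N) * (1 - W) = W ^ j * ((1 - W)\<^sup>2 * (\<Sum>i<N - j. W ^ i))" .
    then show ?thesis using W by (auto intro!: pos_mult pos_square pos_sum pos_power)
  qed
  have "[:1:] - P = W ^ Suc N + (\<Sum>j<Suc N. (W ^ j - W ^ N) * (1 - W))"
  proof -
    have "(\<Sum>j<Suc N. (W ^ j - W ^ N) * (1 - W)) = (1 - W) * (\<Sum>j<Suc N. W ^ j) - P"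
      by (rule real_poly_ext)
        (simp add: P_def sum_distrib_right[symmetric] sum_subtractf poly_sum, simp add: algebra_simps)
    then show ?thesis unfolding geo by (simp add: one_pCons)
  qed
  then have "pos ([:1:] - P)" using W mono
    by (simp only:) (intro pos_add pos_sum pos_power mono, auto)
  moreover have "pos P" unfolding P_def using W by (intro pos_smult pos_mult pos_power) auto
  ultimately have "\<nu> P \<le> 1" by (intro pos_bounded) auto
  moreover have "W ^ N * (1 - W) = smult (1 / (real N + 1)) P" by (simp add: P_def)
  ultimately show ?thesis using smult_le[of "1 / (real N + 1)" P]
    by (simp add: divide_right_mono order_trans)
qed

end

section \<open>Polynomials in a self-adjoint operator\<close>

text \<open>\<open>form_sm\<close> only moves a scalar across the form, so it fits both
  \<open>st x * y\<close>, conjugate-linear in \<open>x\<close>, and the module inner product,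
  conjugate-linear in its second argument. The subspace \<open>R\<close> is there because lower
  bounds will hold on the range only.\<close>

locale selfadjoint_operator =
  fixes sm :: "complex \<Rightarrow> 'x::ab_group_add \<Rightarrow> 'x"
    and R :: "'x set"
    and n :: "'x \<Rightarrow> real"
    and \<beta> :: "'x \<Rightarrow> 'x \<Rightarrow> 'v::ab_group_add"
    and q :: "'v \<Rightarrow> real"
    and h :: "'x \<Rightarrow> 'x"
  assumes sm_add_right: "sm c (x + y) = sm c x + sm c y"
    and sm_add_left: "sm (c + d) x = sm c x + sm d x"
    and sm_mult: "sm (c * d) x = sm c (sm d x)"
    and sm_one: "sm 1 x = x"
    and R_zero: "0 \<in> R"
    and R_add: "x \<in> R \<Longrightarrow> y \<in> R \<Longrightarrow> x + y \<in> R"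
    and R_sm: "x \<in> R \<Longrightarrow> sm c x \<in> R"
    and R_h: "x \<in> R \<Longrightarrow> h x \<in> R"
    and h_add: "h (x + y) = h x + h y"
    and h_sm: "h (sm c x) = sm c (h x)"
    and n_nonneg: "0 \<le> n x"
    and n_add: "n (x + y) \<le> n x + n y"
    and n_sm: "n (sm c x) = cmod c * n x"
    and form_add_left: "\<beta> (x + y) z = \<beta> x z + \<beta> y z"
    and form_add_right: "\<beta> x (y + z) = \<beta> x y + \<beta> x z"
    and form_sm: "\<beta> (sm c x) y = \<beta> x (sm (cnj c) y)"
    and form_h: "\<beta> (h x) y = \<beta> x (h y)"
    and form_self: "q (\<beta> x x) = (n x)\<^sup>2"
    and form_le: "q (\<beta> x y) \<le> n x * n y"
    and h_bounded: "\<exists>K. \<forall>x\<in>R. n (h x) \<le> K * n x"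
begin

section \<open>Evaluation of polynomials at the operator\<close>

lemma sm_zero_right [simp]: "sm c 0 = 0"
  using sm_add_right[of c 0 0] by simp

lemma sm_zero_left [simp]: "sm 0 x = 0"
  using sm_add_left[of 0 0 x] by simp

lemma sm_minus_left: "sm (- c) x = - sm c x"
  using sm_add_left[of "- c" c x] by (simp add: eq_neg_iff_add_eq_0)

lemma h_zero [simp]: "h 0 = 0"
  using h_add[of 0 0] by simp

text \<open>Horner evaluation of \<open>P\<close> at \<open>h\<close>. Constants act as multiples of
  the identity, which supplies the unit that the algebra may lack.\<close>

definition ev :: "real poly \<Rightarrow> 'x \<Rightarrow> 'x" where
  "ev P = fold_coeffs (\<lambda>a f x. sm (of_real a) x + h (f x)) P (\<lambda>_. 0)"

lemma ev_0 [simp]: "ev 0 x = 0"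
  by (simp add: ev_def)

lemma ev_pCons [simp]: "ev (pCons a P) x = sm (of_real a) x + h (ev P x)"
  by (cases "P = 0 \<and> a = 0") (auto simp: ev_def)

lemma ev_1 [simp]: "ev 1 x = x"
  by (simp add: one_pCons sm_one)

lemma ev_add_right: "ev P (x + y) = ev P x + ev P y"
  by (induction P) (simp_all add: sm_add_right h_add add_ac)

lemma ev_sm: "ev P (sm c x) = sm c (ev P x)"
  by (induction P) (simp_all add: sm_add_right h_sm sm_mult[symmetric] mult.commute)

lemma ev_add: "ev (P + Q) x = ev P x + ev Q x"
  by (induction P Q rule: poly_induct2) (simp_all add: sm_add_left h_add add_ac)

lemma ev_smult: "ev (smult c P) x = sm (of_real c) (ev P x)"
  by (induction P) (simp_all add: sm_mult sm_add_right h_sm)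

lemma ev_minus: "ev (- P) x = - ev P x"
  using ev_add[of "- P" P x] by (simp add: eq_neg_iff_add_eq_0)

lemma ev_diff: "ev (P - Q) x = ev P x - ev Q x"
  using ev_add[of P "- Q" x] by (simp add: ev_minus)

lemma ev_mult: "ev (P * Q) x = ev P (ev Q x)"
  by (induction P) (simp_all add: ev_add ev_smult)

lemma ev_R: "x \<in> R \<Longrightarrow> ev P x \<in> R"
  by (induction P) (simp_all add: R_zero R_add R_sm R_h)

lemma form_ev: "\<beta> (ev P x) y = \<beta> x (ev P y)"
proof (induction P arbitrary: x y)
  case 0
  show ?case using form_add_left[of 0 0 y] form_add_right[of x 0 0] by simp
next
  case (pCons a P)
  have "ev P (h y) = h (ev P y)" for y
    using ev_mult[of P "[:0, 1:]" y] ev_mult[of "[:0, 1:]" P y] by (simp add: mult.commute sm_one)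
  then show ?case by (simp add: form_add_left form_add_right form_sm form_h pCons)
qed

section \<open>The operator seminorm on polynomials\<close>

definition bd :: "real poly \<Rightarrow> real \<Rightarrow> bool" where
  "bd P k \<longleftrightarrow> 0 \<le> k \<and> (\<forall>x\<in>R. n (ev P x) \<le> k * n x)"

lemma bdD: "bd P k \<Longrightarrow> x \<in> R \<Longrightarrow> n (ev P x) \<le> k * n x"
  by (simp add: bd_def)

lemma bd_add: "bd P k \<Longrightarrow> bd Q l \<Longrightarrow> bd (P + Q) (k + l)"
  unfolding bd_def ev_add distrib_right by (meson add_mono add_nonneg_nonneg n_add order_trans)

lemma bd_mult: assumes "bd P k" "bd Q l" shows "bd (P * Q) (k * l)"
  unfolding bd_def
proof (intro conjI ballI)
  fix x assume x: "x \<in> R"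
  have "n (ev P (ev Q x)) \<le> k * n (ev Q x)" using assms x by (auto simp: bd_def ev_R)
  also have "\<dots> \<le> k * (l * n x)" using assms x by (auto simp: bd_def intro!: mult_left_mono)
  finally show "n (ev (P * Q) x) \<le> k * l * n x" by (simp add: ev_mult)
qed (use assms in \<open>auto simp: bd_def\<close>)

lemma bd_smult: "bd P k \<Longrightarrow> bd (smult c P) (\<bar>c\<bar> * k)"
  by (auto simp: bd_def ev_smult n_sm mult.assoc intro!: mult_left_mono)

lemma bd_ex: "\<exists>k. bd P k"
proof (induction P)
  case 0
  have "n 0 = 0" using n_sm[of 0 0] by simp
  then show ?case by (intro exI[of _ 0]) (simp add: bd_def)
next
  case (pCons a P)
  obtain k where k: "bd P k" using pCons by blast
  obtain K where K: "\<forall>x\<in>R. n (h x) \<le> K * n x" using h_bounded by blast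
  have "n (h x) \<le> max 0 K * n x" if "x \<in> R" for x
    using K that n_nonneg[of x] by (meson max.cobounded2 mult_right_mono order_trans)
  then have "bd [:0, 1:] (max 0 K)" by (simp add: bd_def sm_one)
  moreover have "bd [:a:] \<bar>a\<bar>" by (simp add: bd_def n_sm)
  moreover have "pCons a P = [:a:] + [:0, 1:] * P" by simp
  ultimately show ?case using bd_add bd_mult k by metis
qed

definition opnorm :: "real poly \<Rightarrow> real" where
  "opnorm P = Inf {k. bd P k}"

lemma opnorm_le: "bd P k \<Longrightarrow> opnorm P \<le> k"
  unfolding opnorm_def by (rule cInf_lower) (auto simp: bd_def intro!: bdd_belowI[of _ 0])

lemma bd_opnorm: "bd P (opnorm P)"
  unfolding bd_def
proof (intro conjI ballI)
  show nonneg: "0 \<le> opnorm P"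
    unfolding opnorm_def using bd_ex[of P] by (intro cInf_greatest) (auto simp: bd_def)
  fix x assume x: "x \<in> R"
  show "n (ev P x) \<le> opnorm P * n x"
  proof (cases "n x = 0")
    case True
    then show ?thesis using bd_ex[of P] x by (auto simp: bd_def)
  next
    case False
    then have pos: "0 < n x" using n_nonneg[of x] by linarith
    have "n (ev P x) / n x \<le> opnorm P"
      unfolding opnorm_def using bd_ex[of P] x pos
      by (intro cInf_greatest) (auto simp: bd_def divide_le_eq)
    then show ?thesis using pos by (simp add: divide_le_eq)
  qed
qed

lemma opnorm_le_iff: "0 \<le> k \<Longrightarrow> opnorm P \<le> k \<longleftrightarrow> (\<forall>x\<in>R. n (ev P x) \<le> k * n x)"
  using opnorm_le[of P k] bd_opnorm[of P] n_nonneg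
  by (auto simp: bd_def) (meson mult_right_mono order_trans)

lemma opnorm_bound: "x \<in> R \<Longrightarrow> n (ev P x) \<le> opnorm P * n x"
  using bd_opnorm by (rule bdD)

text \<open>For \<open>S = Q\<close> and \<open>S = - Q\<close> the product of
  \<open>P - \<i> S\<close> and \<open>P + \<i> S\<close> is \<open>P\<^sup>2 + Q\<^sup>2\<close>,
  so symmetry of the form bounds both \<open>P + \<i> S\<close> by \<open>sqrt k\<close>; their mean
  is \<open>P\<close>.\<close>

lemma bd_square_sum:
  assumes k: "bd (P\<^sup>2 + Q\<^sup>2) k"
  shows "bd P (sqrt k)"
  unfolding bd_def
proof (intro conjI ballI)
  show "0 \<le> sqrt k" using k by (simp add: bd_def)
  fix x assume x: "x \<in> R"
  have L: "n (ev P x + sm \<i> (ev S x)) \<le> sqrt k * n x" if S: "S = Q \<or> S = - Q" for S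
  proof -
    define w where "w = ev P x + sm \<i> (ev S x)"
    have "\<beta> w w = \<beta> x (ev P w) + \<beta> x (sm (- \<i>) (ev S w))"
      by (subst w_def) (simp add: form_add_left form_sm form_ev ev_sm)
    also have "\<dots> = \<beta> x (ev P w - sm \<i> (ev S w))"
      by (simp add: form_add_right[symmetric] sm_minus_left)
    also have "ev P w - sm \<i> (ev S w) = ev (P\<^sup>2 + Q\<^sup>2) x"
    proof -
      have "ev P w = ev (P * P) x + sm \<i> (ev (P * S) x)"
        by (simp add: w_def ev_add_right ev_sm ev_mult)
      moreover have "sm \<i> (ev S w) = sm \<i> (ev (P * S) x) - ev (S * S) x"
        using sm_minus_left[of 1 "ev (S * S) x"]
        by (simp add: w_def ev_add_right ev_sm ev_mult[symmetric] sm_add_right sm_mult[symmetric]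
            sm_one mult.commute)
      moreover have "S * S = Q * Q" using S by auto
      ultimately show ?thesis by (simp add: power2_eq_square ev_add)
    qed
    finally have "(n w)\<^sup>2 \<le> n x * n (ev (P\<^sup>2 + Q\<^sup>2) x)"
      using form_self[of w] form_le[of x "ev (P\<^sup>2 + Q\<^sup>2) x"] by simp
    also have "\<dots> \<le> n x * (k * n x)"
      using bdD[OF k x] n_nonneg by (rule mult_left_mono)
    also have "\<dots> = (sqrt k * n x)\<^sup>2"
      using k by (simp add: bd_def power_mult_distrib power2_eq_square)
    finally have "n w \<le> sqrt k * n x"
      using k n_nonneg by (rule_tac power2_le_imp_le) (auto simp: bd_def)
    then show ?thesis by (simp only: w_def)
  qed
  have "sm 2 (ev P x) = (ev P x + sm \<i> (ev Q x)) + (ev P x + sm \<i> (ev (- Q) x))"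
    using sm_add_left[of 1 1 "ev P x"] sm_add_right[of \<i> "ev Q x" "- ev Q x"]
    by (simp add: sm_one ev_minus)
  then have "2 * n (ev P x) \<le> n (ev P x + sm \<i> (ev Q x)) + n (ev P x + sm \<i> (ev (- Q) x))"
    using n_sm[of 2 "ev P x"] n_add[of "ev P x + sm \<i> (ev Q x)" "ev P x + sm \<i> (ev (- Q) x)"] by simp
  then show "n (ev P x) \<le> sqrt k * n x" using L[of Q] L[of "- Q"] by simp
qed

sublocale real_cstar_seminorm opnorm
proof
  show nn: "0 \<le> opnorm P" for P using bd_opnorm by (simp add: bd_def)
  show "opnorm (P + Q) \<le> opnorm P + opnorm Q" for P Q
    by (intro opnorm_le bd_add bd_opnorm)
  show "opnorm (P * Q) \<le> opnorm P * opnorm Q" for P Q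
    by (intro opnorm_le bd_mult bd_opnorm)
  show "opnorm (smult c P) \<le> \<bar>c\<bar> * opnorm P" for c P
    by (intro opnorm_le bd_smult bd_opnorm)
  show "opnorm 1 \<le> 1" by (intro opnorm_le) (simp add: bd_def)
  show "(opnorm P)\<^sup>2 \<le> opnorm (P\<^sup>2 + Q\<^sup>2)" for P Q
    using opnorm_le[OF bd_square_sum[OF bd_opnorm, of P Q]] nn
    by (metis power2_eq_square power_mono real_sqrt_pow2)
qed

text \<open>Accretivity of \<open>h\<close> makes \<open>1 - e h\<close> a contraction up to an error of order \<open>e\<^sup>2\<close>,
  because \<open>(1 + e h)(1 - e h) = 1 - e\<^sup>2 h\<^sup>2\<close>.\<close>

lemma pos_of_accretive:
  assumes acc: "\<And>e x. 0 < e \<Longrightarrow> x \<in> R \<Longrightarrow> n x \<le> n (x + sm (of_real e) (h x))"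
  shows "pos [:0, 1:]"
proof (rule pos_limit)
  fix d :: real assume d: "0 < d"
  define K where "K = opnorm ([:0, 1:]\<^sup>2)"
  have K0: "0 \<le> K" by (simp add: K_def)
  define e where "e = d / (K + 1)"
  have e: "0 < e" "e * K \<le> d" using d K0 by (auto simp: e_def field_simps)
  have contr: "opnorm [:1, - e:] \<le> 1 + e\<^sup>2 * K"
  proof (rule opnorm_le, unfold bd_def, intro conjI ballI)
    fix x assume x: "x \<in> R"
    define w where "w = ev [:1, - e:] x"
    have w: "w \<in> R" using x by (simp only: w_def ev_R)
    have "n w \<le> n (w + sm (of_real e) (h w))" using e(1) w by (rule acc)
    also have "w + sm (of_real e) (h w) = ev [:1, e:] w"
      by (simp add: sm_one h_sm)
    also have "\<dots> = ev ([:1, e:] * [:1, - e:]) x" by (simp only: w_def ev_mult)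
    also have "[:1, e:] * [:1, - e:] = 1 - smult (e\<^sup>2) ([:0, 1:]\<^sup>2)"
      by (rule real_poly_ext) (simp add: algebra_simps power2_eq_square)
    also have "n (ev (1 - smult (e\<^sup>2) ([:0, 1:]\<^sup>2)) x) \<le> opnorm (1 - smult (e\<^sup>2) ([:0, 1:]\<^sup>2)) * n x"
      by (rule opnorm_bound[OF x])
    also have "\<dots> \<le> (1 + e\<^sup>2 * K) * n x"
      using diff_le[of 1 "smult (e\<^sup>2) ([:0, 1:]\<^sup>2)"] one_le smult_le[of "e\<^sup>2" "[:0, 1:]\<^sup>2"] n_nonneg[of x]
      by (intro mult_right_mono) (auto simp: K_def)
    finally show "n (ev [:1, - e:] x) \<le> (1 + e\<^sup>2 * K) * n x" by (simp only: w_def)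
  qed (simp add: K0)
  \<comment> \<open>Now \<open>t - (h + d) = (1 - e h) / e\<close> has norm at most
    \<open>1 / e + e K\<close>, and \<open>e\<close> was chosen so that this is at most
    \<open>t\<close>.\<close>
  define t where "t = 1 / e + d"
  have "[:t:] - ([:0, 1:] + [:d:]) = smult (1 / e) [:1, - e:]"
    using e by (intro real_poly_ext) (simp add: t_def field_simps)
  then have "opnorm ([:t:] - ([:0, 1:] + [:d:])) \<le> 1 / e * opnorm [:1, - e:]"
    using smult_le[of "1 / e" "[:1, - e:]"] e by simp
  also have "\<dots> \<le> 1 / e * (1 + e\<^sup>2 * K)" using contr e by (intro mult_left_mono) auto
  also have "\<dots> = 1 / e + e * K" using e by (simp add: field_simps power2_eq_square)
  also have "\<dots> \<le> t" using e by (simp add: t_def)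
  finally show "pos ([:0, 1:] + [:d:])" using e d by (intro posI[of t]) (auto simp: t_def)
qed

text \<open>A positive operator that is bounded below has \<open>\<epsilon>\<close>-dense range: with \<open>W = 1 - P / s\<close>
  and \<open>u = (1 + W + \<dots> + W\<^bsup>N-1\<^esup>) z / s\<close> the residual is \<open>z - P u = W\<^sup>N z\<close>, and
  \<open>W\<^sup>N (1 - W)\<close> tends to \<open>0\<close>.\<close>

lemma pos_bounded_below_dense_range:
  assumes P: "pos P" and d: "0 < d" and below: "\<And>x. x \<in> R \<Longrightarrow> d * n x \<le> n (ev P x)"
    and z: "z \<in> R" and e: "0 < e"
  shows "\<exists>u\<in>R. n (ev P u - z) < e"
proof -
  define s where "s = opnorm P + 1"
  have s: "0 < s" using nonneg[of P] unfolding s_def by linarith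
  define W where "W = 1 - smult (1 / s) P"
  have PW: "P = smult s (1 - W)" using s by (simp add: W_def)
  have "pos ([:s:] - P)" by (rule pos_const_diff) (simp add: s_def)
  then have "pos (smult (1 / s) ([:s:] - P))" using s by (intro pos_smult) auto
  moreover have "smult (1 / s) ([:s:] - P) = W"
    using s by (intro real_poly_ext) (simp add: W_def field_simps)
  ultimately have W: "pos W" by simp
  have W1: "pos (1 - W)" using pos_smult[OF P, of "1 / s"] s by (simp add: W_def)
  obtain N where N: "s * n z / (d * e) < real N" using reals_Archimedean2 by blast
  have "d * n (ev (W ^ N) z) \<le> n (ev P (ev (W ^ N) z))" by (rule below[OF ev_R[OF z]])
  also have "\<dots> = n (ev (smult s (W ^ N * (1 - W))) z)"
    by (subst PW) (simp only: ev_mult[symmetric] mult_smult_left mult.commute[of "1 - W"])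
  also have "\<dots> \<le> s * (1 / (real N + 1)) * n z"
  proof -
    have "opnorm (smult s (W ^ N * (1 - W))) \<le> s * (1 / (real N + 1))"
      using smult_le[of s "W ^ N * (1 - W)"] power_mult_one_minus_le[OF W W1, of N] s
      by (smt (verit) mult_left_mono)
    then show ?thesis
      by (intro order_trans[OF opnorm_bound[OF z]] mult_right_mono n_nonneg)
  qed
  also have "\<dots> < d * e"
  proof -
    have "s * n z < real N * (d * e)" using N d e by (simp add: divide_less_eq)
    also have "\<dots> \<le> (real N + 1) * (d * e)" using d e by (intro mult_right_mono) auto
    finally show ?thesis by (simp add: field_simps)
  qed
  finally have small: "n (ev (W ^ N) z) < e" using d by simp
  define u where "u = ev (smult (1 / s) (\<Sum>j<N. W ^ j)) z"
  have "P * smult (1 / s) (\<Sum>j<N. W ^ j) = 1 - W ^ N"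
    using s one_diff_power_eq[of W N] by (subst PW) simp
  then have "ev P u - z = - ev (W ^ N) z"
    by (simp add: u_def ev_mult[symmetric] ev_diff)
  then have "ev P u - z = sm (- 1) (ev (W ^ N) z)" by (simp add: sm_minus_left sm_one)
  then have "n (ev P u - z) < e" using small n_sm[of "- 1" "ev (W ^ N) z"] by simp
  then show ?thesis using ev_R[OF z] by (auto simp: u_def)
qed

end

section \<open>Positivity under a C*-seminorm\<close>

locale cstar_seminormed =
  fixes A :: "'a::ring pro_alg" and p :: "'a \<Rightarrow> real"
  assumes star_algebra: "star_algebra A" and cstar: "cstar_seminorm A p"
begin

abbreviation sm where "sm \<equiv> smulA A"
abbreviation st where "st \<equiv> star A"

lemma
  shows sm_add_right: "sm c (x + y) = sm c x + sm c y"
    and sm_add_left: "sm (c + d) x = sm c x + sm d x"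
    and sm_mult: "sm (c * d) x = sm c (sm d x)"
    and sm_one: "sm 1 x = x"
    and mult_sm_left: "sm c x * y = sm c (x * y)"
    and mult_sm_right: "x * sm c y = sm c (x * y)"
    and st_add: "st (x + y) = st x + st y"
    and st_sm: "st (sm c x) = sm (cnj c) (st x)"
    and st_mult: "st (x * y) = st y * st x"
    and st_st [simp]: "st (st x) = x"
  using star_algebra unfolding star_algebra_def by metis+

lemma
  shows p_nonneg [simp]: "0 \<le> p x"
    and p_add: "p (x + y) \<le> p x + p y"
    and p_sm: "p (sm c x) = cmod c * p x"
    and p_mult: "p (x * y) \<le> p x * p y"
    and p_st_mult_self: "p (st x * x) = (p x)\<^sup>2"
  using cstar unfolding cstar_seminorm_def by blast+

lemma sm_zero [simp]: "sm 0 x = 0" "sm c 0 = 0"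
  using sm_add_left[of 0 0 x] sm_add_right[of c 0 0] by simp_all

lemma sm_minus_left: "sm (- c) x = - sm c x"
  using sm_add_left[of "- c" c x] by (simp add: eq_neg_iff_add_eq_0)

lemma sm_minus_right: "sm c (- x) = - sm c x"
  using sm_add_right[of c "- x" x] by (simp add: eq_neg_iff_add_eq_0)

lemma sm_diff_right: "sm c (x - y) = sm c x - sm c y"
  using sm_add_right[of c x "- y"] by (simp add: sm_minus_right)

lemma st_minus: "st (- x) = - st x"
  using st_add[of "- x" x] st_add[of 0 0] by (simp add: eq_neg_iff_add_eq_0)

lemma p_minus: "p (- x) = p x"
  using p_sm[of "- 1" x] by (simp add: sm_minus_left sm_one)

lemma p_zero [simp]: "p 0 = 0"
  using p_sm[of 0 0] by simp

lemma p_st: "p (st x) = p x"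
proof -
  have le: "p x \<le> p (st x)" for x
    using p_mult[of "st x" x] p_st_mult_self[of x] p_nonneg[of x] p_nonneg[of "st x"]
    by (cases "p x = 0") (auto simp: power2_eq_square)
  show ?thesis using le[of x] le[of "st x"] by simp
qed

text \<open>The left regular representation: polynomials with constant term become operators on the
  algebra even when it has no unit.\<close>

lemma left_mult_selfadjoint:
  assumes h: "st h = h"
  shows "selfadjoint_operator sm UNIV p (\<lambda>x y. st x * y) p ((*) h)"
proof
  show "p (st x * y) \<le> p x * p y" for x y using p_mult[of "st x" y] by (simp add: p_st)
  show "\<exists>K. \<forall>x\<in>UNIV. p (h * x) \<le> K * p x" using p_mult by blast
qed (simp_all add: sm_add_right sm_add_left sm_mult sm_one mult_sm_left mult_sm_right st_add st_sm
    st_mult p_add p_sm p_st_mult_self h mult.assoc distrib_left distrib_right)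

text \<open>\<open>nonneg c g\<close> expresses \<open>c + g \<ge> 0\<close> in the unitization.\<close>

definition nonneg :: "real \<Rightarrow> 'a \<Rightarrow> bool" where
  "nonneg c g \<longleftrightarrow> (\<exists>t\<ge>0. \<forall>y. p (sm (of_real (t - c)) y - g * y) \<le> t * p y)"

lemma nonneg_add:
  assumes "nonneg c g" "nonneg d k"
  shows "nonneg (c + d) (g + k)"
proof -
  obtain t where t: "t \<ge> 0" "\<And>y. p (sm (of_real (t - c)) y - g * y) \<le> t * p y"
    using assms by (auto simp: nonneg_def)
  obtain s where s: "s \<ge> 0" "\<And>y. p (sm (of_real (s - d)) y - k * y) \<le> s * p y"
    using assms by (auto simp: nonneg_def)
  have "p (sm (of_real (t + s - (c + d))) y - (g + k) * y) \<le> (t + s) * p y" for y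
  proof -
    have "complex_of_real (t + s - (c + d)) = of_real (t - c) + of_real (s - d)" by simp
    then have "sm (of_real (t + s - (c + d))) y - (g + k) * y
        = (sm (of_real (t - c)) y - g * y) + (sm (of_real (s - d)) y - k * y)"
      by (simp only: sm_add_left distrib_right algebra_simps)
    then show ?thesis
      using p_add[of "sm (of_real (t - c)) y - g * y" "sm (of_real (s - d)) y - k * y"] t(2)[of y] s(2)[of y]
      by (simp only: distrib_right)
  qed
  then show ?thesis using t(1) s(1) unfolding nonneg_def by (intro exI[of _ "t + s"]) auto
qed

text \<open>\<open>nonneg\<close> does not mention \<open>h\<close>, so elements that do not commute
  can be added under it; for every other purpose an element is viewed as a polynomial in a single
  \<open>h\<close>.\<close>

lemma nonneg_iff_pos:
  assumes h: "st h = h" and P: "\<And>y. selfadjoint_operator.ev sm ((*) h) P y = g * y"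
  shows "nonneg c g \<longleftrightarrow>
    real_cstar_seminorm.pos (selfadjoint_operator.opnorm sm UNIV p ((*) h)) ([:c:] + P)"
proof -
  interpret H: selfadjoint_operator sm UNIV p "\<lambda>x y. st x * y" p "(*) h"
    by (rule left_mult_selfadjoint[OF h])
  have "H.ev ([:t:] - ([:c:] + P)) y = sm (of_real (t - c)) y - g * y" for t y
    using sm_add_left[of "of_real t" "- of_real c" y]
    by (simp add: H.ev_diff H.ev_add P sm_minus_left)
  then show ?thesis by (simp add: nonneg_def H.pos_def H.opnorm_le_iff cong: conj_cong)
qed

text \<open>By the C*-identity the vector \<open>st g\<close> attains the bound.\<close>

lemma opnorm_eq:
  assumes h: "st h = h" and P: "\<And>y. selfadjoint_operator.ev sm ((*) h) P y = g * y"
  shows "selfadjoint_operator.opnorm sm UNIV p ((*) h) P = p g"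
proof -
  interpret H: selfadjoint_operator sm UNIV p "\<lambda>x y. st x * y" p "(*) h"
    by (rule left_mult_selfadjoint[OF h])
  show ?thesis
  proof (rule antisym)
    show "H.opnorm P \<le> p g" by (simp add: H.opnorm_le_iff P p_mult)
    have "(p g)\<^sup>2 \<le> H.opnorm P * p g"
      using H.opnorm_bound[of "st g" P] p_st_mult_self[of "st g"] by (simp add: P p_st)
    moreover have "0 < p g" if "p g \<noteq> 0" using that p_nonneg[of g] by linarith
    ultimately show "p g \<le> H.opnorm P"
      by (cases "p g = 0") (auto simp: power2_eq_square)
  qed
qed

lemma ev_id: "st h = h \<Longrightarrow> selfadjoint_operator.ev sm ((*) h) [:0, 1:] y = h * y"
  by (simp add: selfadjoint_operator.ev_pCons[OF left_mult_selfadjoint]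
      selfadjoint_operator.ev_0[OF left_mult_selfadjoint] sm_one)

lemma nonneg_square:
  assumes "st h = h"
  shows "nonneg 0 (h * h)"
proof -
  interpret H: selfadjoint_operator sm UNIV p "\<lambda>x y. st x * y" p "(*) h"
    by (rule left_mult_selfadjoint[OF assms])
  have "H.ev ([:0, 1:]\<^sup>2) y = h * h * y" for y
    by (simp only: power2_eq_square H.ev_mult ev_id[OF assms] mult.assoc)
  from nonneg_iff_pos[OF assms this, of 0] show ?thesis using H.pos_square by simp
qed

lemma nonneg_of_norm_le: "p g \<le> s \<Longrightarrow> nonneg s g"
proof -
  assume le: "p g \<le> s"
  have "p (sm (of_real (s - s)) y - g * y) \<le> s * p y" for y
    using p_mult[of g y] mult_right_mono[OF le p_nonneg[of y]] by (simp add: p_minus)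
  moreover have "0 \<le> s" using le p_nonneg[of g] by linarith
  ultimately show ?thesis unfolding nonneg_def by blast
qed

lemma norm_le_of_nonneg:
  assumes h: "st h = h" and "nonneg 0 h" "nonneg s (- h)" "0 \<le> s"
  shows "p h \<le> s"
proof -
  interpret H: selfadjoint_operator sm UNIV p "\<lambda>x y. st x * y" p "(*) h"
    by (rule left_mult_selfadjoint[OF h])
  have "H.pos ([:0:] + [:0, 1:])" using nonneg_iff_pos[OF h ev_id[OF h]] assms by blast
  moreover have "H.ev (- [:0, 1:]) y = - h * y" for y
    using ev_id[OF h] by (simp only: H.ev_minus minus_mult_left)
  then have "H.pos ([:s:] + - [:0, 1:])" using nonneg_iff_pos[OF h] assms by blast
  ultimately have "H.opnorm [:0, 1:] \<le> s" using assms by (intro H.pos_bounded) auto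
  then show ?thesis using opnorm_eq[OF h ev_id[OF h]] by simp
qed

text \<open>Up to sign, \<open>u\<close> and \<open>v\<close> are \<open>sqrt 2\<close> times the
  real and imaginary parts of \<open>w\<close>, and the element is
  \<open>u * u + v * v\<close>.\<close>

lemma nonneg_sum_star_mult: "nonneg 0 (st w * w + w * st w)"
proof -
  define a where "a = complex_of_real (sqrt (1/2))"
  have a: "a * a = 1/2" "cnj a = a" by (simp_all add: a_def flip: of_real_mult)
  define u where "u = sm a (w + st w)"
  define v where "v = sm (\<i> * a) (w - st w)"
  have "st u = u" by (simp add: u_def st_sm st_add a add.commute)
  moreover have "st v = v"
    using st_add[of w "- st w"] sm_minus_left[of "\<i> * a" "st w - w"]
    by (simp add: v_def st_sm st_minus a flip: sm_minus_right)
  moreover have "u * u + v * v = st w * w + w * st w"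
  proof -
    have "u * u = sm (1/2) ((w + st w) * (w + st w))"
      by (simp add: u_def mult_sm_left mult_sm_right a flip: sm_mult)
    moreover have "v * v = sm (- (1/2)) ((w - st w) * (w - st w))"
    proof -
      have "(\<i> * a) * (\<i> * a) = - (1/2)" using a by (simp add: algebra_simps)
      then show ?thesis by (simp only: v_def mult_sm_left mult_sm_right flip: sm_mult)
    qed
    ultimately have "u * u + v * v = sm (1/2) ((w + st w) * (w + st w) - (w - st w) * (w - st w))"
      by (simp add: sm_minus_left sm_diff_right)
    also have "(w + st w) * (w + st w) - (w - st w) * (w - st w)
        = (st w * w + w * st w) + (st w * w + w * st w)"
      by (simp add: algebra_simps)
    also have "sm (1/2) \<dots> = st w * w + w * st w"
      unfolding sm_add_right[of _ "st w * w + w * st w"] sm_add_left[symmetric] by (simp add: sm_one)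
    finally show ?thesis .
  qed
  ultimately show ?thesis using nonneg_add[OF nonneg_square nonneg_square, of u v] by simp
qed

text \<open>\<open>X = w\<^sup>*w\<close> and \<open>Z = ww\<^sup>*\<close> have the same norm \<open>s\<close>, and so do \<open>X(X + s)\<^sup>2\<close> and \<open>Z(Z + s)\<^sup>2\<close>.
  But \<open>-s \<le> X \<le> \<eta>\<close> makes the former of size about \<open>4s\<^sup>3/27\<close>, and \<open>-\<eta> \<le> Z \<le> s\<close> the latter
  of size about \<open>4s\<^sup>3\<close>.\<close>

lemma norm_le_of_opposite_signs:
  assumes eta: "0 \<le> \<eta>" and X: "nonneg \<eta> (- (st w * w))" and Z: "nonneg \<eta> (w * st w)"
  shows "(p w)\<^sup>2 \<le> 6 * \<eta>"
proof -
  define s where "s = (p w)\<^sup>2"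
  have s0: "0 \<le> s" by (simp add: s_def)
  define x where "x = st w * w"
  define z where "z = w * st w"
  have sax: "st x = x" and saz: "st z = z" by (simp_all add: x_def z_def st_mult)
  have px: "p x = s" and pz: "p z = s"
    using p_st_mult_self[of w] p_st_mult_self[of "st w"] by (simp_all add: x_def z_def s_def p_st)
  interpret X: selfadjoint_operator sm UNIV p "\<lambda>x y. st x * y" p "(*) x"
    by (rule left_mult_selfadjoint[OF sax])
  interpret Z: selfadjoint_operator sm UNIV p "\<lambda>x y. st x * y" p "(*) z"
    by (rule left_mult_selfadjoint[OF saz])
  define t :: "real poly" where "t = [:0, 1:]"
  have evx: "X.ev t y = x * y" and evz: "Z.ev t y = z * y" for y
    using ev_id[OF sax] ev_id[OF saz] by (simp_all add: t_def)
  have nx: "X.opnorm t = s" and nz: "Z.opnorm t = s"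
    using opnorm_eq[OF sax evx] opnorm_eq[OF saz evz] px pz by simp_all
  define Q where "Q = t * ([:s:] + t)\<^sup>2"
  have Q: "Q = [:0, s\<^sup>2, 2 * s, 1:]" unfolding Q_def t_def
    by (rule real_poly_ext) (simp add: algebra_simps power2_eq_square)
  \<comment> \<open>\<open>k\<close> stands for \<open>w (x + s)\<close>: then
    \<open>st k * k = x (x + s)^2\<close> and \<open>k * st k = z (z + s)^2\<close>, which carries
    the norm of \<open>Q\<close> from \<open>x\<close> to \<open>z\<close>.\<close>
  define k where "k = w * x + sm (of_real s) w"
  have two: "sm (of_real (2 * s)) y = sm (of_real s) y + sm (of_real s) y" for y
    by (simp add: sm_add_left[symmetric])
  have s2: "sm (of_real (s\<^sup>2)) y = sm (of_real s) (sm (of_real s) y)" for y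
    by (simp add: sm_mult[symmetric] power2_eq_square)
  have "X.ev Q y = st k * k * y" for y
    unfolding Q k_def X.ev_pCons X.ev_0
    by (simp add: two s2 sm_one st_add st_sm st_mult sax mult_sm_left mult_sm_right sm_add_right
        distrib_left distrib_right mult.assoc add_ac x_def del: of_real_mult of_real_power)
  then have nQx: "X.opnorm Q = (p k)\<^sup>2" using opnorm_eq[OF sax] p_st_mult_self by simp
  have "Z.ev Q y = k * st k * y" for y
    unfolding Q k_def Z.ev_pCons Z.ev_0
    by (simp add: two s2 sm_one st_add st_sm st_mult sax mult_sm_left mult_sm_right sm_add_right
        distrib_left distrib_right mult.assoc add_ac x_def z_def del: of_real_mult of_real_power)
  then have nQz: "Z.opnorm Q = (p k)\<^sup>2"
    using opnorm_eq[OF saz] p_st_mult_self[of "st k"] by (simp add: p_st)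
  have posX: "X.pos ([:\<eta>:] - t)"
    using nonneg_iff_pos[OF sax, of "- t" "- x" \<eta>] X[folded x_def] by (simp add: X.ev_minus evx)
  have posZ: "Z.pos ([:\<eta>:] + t)"
    using nonneg_iff_pos[OF saz evz, of \<eta>] Z by (simp add: z_def)
  \<comment> \<open>On \<open>[- s, 0]\<close> the minimum of \<open>t (t + s)^2\<close> is
    \<open>- 4 s^3 / 27\<close>, at \<open>- s / 3\<close>; hence the factor
    \<open>(t + s / 3)^2\<close> below. The summand \<open>4 \<eta> s^2\<close> pays for
    \<open>\<eta> (t + s)^2\<close>.\<close>
  define b where "b = 4 * s ^ 3 / 27 + 4 * \<eta> * s\<^sup>2"
  have b0: "0 \<le> b" using s0 eta by (simp add: b_def)
  have b: "X.opnorm Q \<le> b"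
  proof (rule X.sym_bounded[OF _ _ b0])
    have "[:b:] + Q = ([:s/3:] + t)\<^sup>2 * (([:s:] + t) + [:s/3:]) + [:4 * \<eta> * s\<^sup>2:]"
      unfolding Q_def b_def
      by (rule real_poly_ext) (simp add: field_simps power2_eq_square power3_eq_cube)
    moreover have "X.pos (([:s/3:] + t)\<^sup>2 * (([:s:] + t) + [:s/3:]) + [:4 * \<eta> * s\<^sup>2:])"
      using s0 eta by (intro X.pos_add[of "_ * _"] X.pos_mult X.pos_square X.pos_add[of "[:s:] + t"] X.pos_const_add X.pos_const)
        (auto simp: nx)
    ultimately show "X.pos ([:b:] + Q)" by simp
    have "[:b:] - Q = [:4 * s ^ 3 / 27:] + (([:\<eta>:] - t) * ([:s:] + t)\<^sup>2
        + smult \<eta> (([:s:] - t) * (([:s:] + t) + [:2 * s:])))"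
      unfolding Q_def b_def
      by (rule real_poly_ext) (simp add: algebra_simps power2_eq_square power3_eq_cube)
    moreover have "X.pos ([:4 * s ^ 3 / 27:] + (([:\<eta>:] - t) * ([:s:] + t)\<^sup>2
        + smult \<eta> (([:s:] - t) * (([:s:] + t) + [:2 * s:]))))"
      using s0 eta posX
      by (intro X.pos_add[of "[:4 * s ^ 3 / 27:]"] X.pos_add[of "_ * _"] X.pos_smult X.pos_mult
          X.pos_square X.pos_add[of "[:s:] + t"] X.pos_const_add
          X.pos_const_diff[of t s] X.pos_const) (auto simp: nx)
    ultimately show "X.pos ([:b:] - Q)" by simp
  qed
  \<comment> \<open>\<open>F\<close> simplifies to \<open>Q + \<eta> (s^2 + t^2)\<close>, so
    \<open>F - 2 s t^2 = (t + \<eta>) (t^2 + s^2)\<close> is positive. The \<open>6\<close> is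
    \<open>4 + 2\<close>, from the two correction terms in \<open>F\<close>.\<close>
  define g where "g = b + 6 * \<eta> * s\<^sup>2"
  define F where "F = Q + (smult \<eta> (([:s:] + t)\<^sup>2) + smult (- 2 * s * \<eta>) t)"
  have "Z.opnorm F \<le> g"
  proof -
    have st: "Z.opnorm ([:s:] + t) \<le> 2 * s"
      using Z.add_le[of "[:s:]" t] Z.const_le[of s] nz s0 by simp
    have "Z.opnorm (smult \<eta> (([:s:] + t)\<^sup>2)) \<le> \<eta> * Z.opnorm (([:s:] + t)\<^sup>2)"
      using Z.smult_le[of \<eta>] eta by simp
    also have "\<dots> \<le> \<eta> * (2 * s)\<^sup>2"
      unfolding Z.square using st eta by (intro mult_left_mono power_mono) auto
    finally have "Z.opnorm (smult \<eta> (([:s:] + t)\<^sup>2)) \<le> 4 * \<eta> * s\<^sup>2" by (simp add: power_mult_distrib)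
    moreover have "Z.opnorm (smult (- 2 * s * \<eta>) t) \<le> 2 * \<eta> * s\<^sup>2"
      using Z.smult_le[of "- 2 * s * \<eta>" t] nz s0 eta by (simp add: abs_mult power2_eq_square mult_ac)
    moreover have "Z.opnorm F \<le> Z.opnorm Q
        + (Z.opnorm (smult \<eta> (([:s:] + t)\<^sup>2)) + Z.opnorm (smult (- 2 * s * \<eta>) t))"
      unfolding F_def by (intro order_trans[OF Z.add_le] add_left_mono Z.add_le)
    ultimately show ?thesis using b nQx nQz by (simp add: g_def)
  qed
  then have "Z.pos ([:g:] - F)" by (rule Z.pos_const_diff)
  moreover have "[:g:] - smult (2 * s) (t\<^sup>2)
      = ([:g:] - F) + (([:\<eta>:] + t) * t\<^sup>2 + smult (s\<^sup>2) ([:\<eta>:] + t))"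
    unfolding F_def Q_def
    by (rule real_poly_ext) (simp add: algebra_simps power2_eq_square power3_eq_cube)
  ultimately have "Z.pos ([:g:] - smult (2 * s) (t\<^sup>2))"
    using posZ by (simp only:) (intro Z.pos_add[of "[:g:] - F"] Z.pos_add[of "_ * _"] Z.pos_mult
      Z.pos_square Z.pos_smult, auto)
  moreover have "Z.pos (smult (2 * s) (t\<^sup>2))" using s0 by (intro Z.pos_smult Z.pos_square) auto
  moreover have "0 \<le> g" using b0 eta by (simp add: g_def)
  ultimately have "Z.opnorm (smult (2 * s) (t\<^sup>2)) \<le> g" by (intro Z.pos_bounded)
  moreover have "2 * s ^ 3 \<le> Z.opnorm (smult (2 * s) (t\<^sup>2))"
  proof (cases "s = 0")
    case False
    have "Z.opnorm (smult (1 / (2 * s)) (smult (2 * s) (t\<^sup>2)))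
        \<le> 1 / (2 * s) * Z.opnorm (smult (2 * s) (t\<^sup>2))"
      using Z.smult_le[of "1 / (2 * s)" "smult (2 * s) (t\<^sup>2)"] s0 by simp
    then have "s\<^sup>2 \<le> 1 / (2 * s) * Z.opnorm (smult (2 * s) (t\<^sup>2))"
      using False by (simp add: Z.square nz)
    then show ?thesis using False s0 by (simp add: field_simps power2_eq_square power3_eq_cube)
  qed simp
  ultimately have "2 * s ^ 3 \<le> 4 * s ^ 3 / 27 + 10 * \<eta> * s\<^sup>2" by (simp add: g_def b_def)
  \<comment> \<open>\<open>2 - 4 / 27 = 50 / 27\<close>, so the constant is \<open>27 / 5\<close>,
    rounded up to \<open>6\<close>.\<close>
  then have "s\<^sup>2 * (50 * s) \<le> s\<^sup>2 * (270 * \<eta>)"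
    by (simp add: power2_eq_square power3_eq_cube mult_ac)
  then show ?thesis
    unfolding s_def[symmetric] using s0 eta by (cases "s = 0") auto
qed

text \<open>Kaplansky's theorem. For \<open>w = c(M - h)\<^sup>n\<close> one has \<open>w\<^sup>*w = h(M - h)\<^bsup>2n\<^esup> \<le> M\<^bsup>2n+1\<^esup>\<close>, so
  the previous bound limits the growth of \<open>\<parallel>M - h\<parallel>\<^bsup>2n\<^esup>\<close>, which excludes \<open>\<parallel>M - h\<parallel> > M\<close>.\<close>

lemma nonneg_star_mult_self: "nonneg 0 (st c * c)"
proof -
  define h where "h = st c * c"
  have sah: "st h = h" by (simp add: h_def st_mult)
  interpret H: selfadjoint_operator sm UNIV p "\<lambda>x y. st x * y" p "(*) h"
    by (rule left_mult_selfadjoint[OF sah])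
  define t :: "real poly" where "t = [:0, 1:]"
  have evt: "H.ev t y = h * y" for y using ev_id[OF sah] by (simp add: t_def)
  define M where "M = p h + 1"
  have M: "0 < M" using p_nonneg[of h] unfolding M_def by linarith
  have tM: "H.opnorm t \<le> M" using opnorm_eq[OF sah evt] by (simp add: M_def)
  define V where "V = [:M:] - t"
  have posV: "H.pos V" unfolding V_def using tM by (rule H.pos_const_diff)
  have evV: "H.ev V y = sm (of_real M) y - h * y" for y by (simp add: V_def H.ev_diff evt)
  \<comment> \<open>The recursion produces \<open>c (M - h)^n\<close> although \<open>M - h\<close>
    itself need not be an element of the algebra.\<close>
  define w where "w = rec_nat c (\<lambda>_ w. sm (of_real M) w - w * h)"
  have w0: "w 0 = c" and wS: "w (Suc n) = sm (of_real M) (w n) - w n * h" for n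
    by (simp_all add: w_def)
  have ww: "H.ev (t * V ^ (2 * n)) y = st (w n) * w n * y" for n y
  proof (induction n arbitrary: y)
    case 0
    show ?case by (simp add: evt w0) (simp add: h_def)
  next
    case (Suc n)
    have "t * V ^ (2 * Suc n) = V * (t * V ^ (2 * n)) * V" by (simp add: mult_ac)
    then have "H.ev (t * V ^ (2 * Suc n)) y = H.ev V (st (w n) * w n * H.ev V y)"
      by (simp only: H.ev_mult Suc[symmetric])
    also have "\<dots> = st (w (Suc n)) * w (Suc n) * y"
    proof -
      have "st (w (Suc n)) = sm (of_real M) (st (w n)) - h * st (w n)"
        using st_add[of "sm (of_real M) (w n)" "- (w n * h)"]
        by (simp add: wS st_sm st_minus st_mult sah)
      then show ?thesis
        by (simp add: evV wS mult_sm_left mult_sm_right left_diff_distrib right_diff_distrib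
            sm_diff_right mult.assoc)
    qed
    finally show ?case .
  qed
  have posn: "H.pos ([:M ^ (2 * n + 1):] - t * V ^ (2 * n))" for n
  proof -
    define m where "m = 2 * n"
    \<comment> \<open>Since \<open>t = M - V\<close>, the difference of powers contributes a second
      factor \<open>M - V\<close>. The resulting square is positive whatever the sign of
      \<open>t\<close>, which is still to be found.\<close>
    have "[:M ^ (m + 1):] - t * V ^ m
        = ([:M:] - V) * ([:M:] ^ m - V ^ m) + smult (M ^ m) V"
      by (rule real_poly_ext) (simp add: V_def algebra_simps)
    also have "[:M:] ^ m - V ^ m = ([:M:] - V) * (\<Sum>i<m. V ^ (m - Suc i) * [:M:] ^ i)"
      by (rule power_diff_sumr2)
    finally have "[:M ^ (m + 1):] - t * V ^ m
        = ([:M:] - V)\<^sup>2 * (\<Sum>i<m. V ^ (m - Suc i) * [:M:] ^ i) + smult (M ^ m) V"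
      by (simp only: power2_eq_square mult.assoc)
    moreover have "H.pos (([:M:] - V)\<^sup>2 * (\<Sum>i<m. V ^ (m - Suc i) * [:M:] ^ i) + smult (M ^ m) V)"
      using M by (intro H.pos_add[of "_ * _"] H.pos_mult H.pos_square H.pos_sum H.pos_power posV H.pos_smult H.pos_const) auto
    ultimately show ?thesis by (simp only: m_def)
  qed
  have wn: "(p (w n))\<^sup>2 \<le> 6 * M ^ (2 * n + 1)" for n
  proof (rule norm_le_of_opposite_signs)
    show "0 \<le> M ^ (2 * n + 1)" using M by simp
    have ev': "H.ev (- (t * V ^ (2 * n))) y = - (st (w n) * w n) * y" for y
      using H.ev_minus[of "t * V ^ (2 * n)" y] ww[of n y] by simp
    show neg: "nonneg (M ^ (2 * n + 1)) (- (st (w n) * w n))"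
      using nonneg_iff_pos[OF sah ev'] posn[of n] by simp
    \<comment> \<open>\<open>w w^*\<close> is the sum of \<open>w^* w + w w^*\<close>, which is
      positive, and \<open>- w^* w\<close>.\<close>
    show "nonneg (M ^ (2 * n + 1)) (w n * st (w n))"
      using nonneg_add[OF neg nonneg_sum_star_mult[of "w n"]] by simp
  qed
  have "H.opnorm V \<le> M"
  proof (rule ccontr)
    assume "\<not> H.opnorm V \<le> M"
    define \<theta> where "\<theta> = H.opnorm V"
    have th: "M < \<theta>" using \<open>\<not> H.opnorm V \<le> M\<close> by (simp add: \<theta>_def)
    \<comment> \<open>Multiplying \<open>V = M - t\<close> by \<open>V^(2 n)\<close> bounds
      \<open>\<theta>^(2 n + 1)\<close> by \<open>M \<theta>^(2 n)\<close> plus the norm of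
      \<open>t V^(2 n)\<close>, which is \<open>(p (w n))^2\<close>.\<close>
    have bound: "\<theta> ^ (2 * n) * (\<theta> - M) \<le> 6 * M ^ (2 * n + 1)" if n: "0 < n" for n
    proof -
      have "\<theta> ^ (2 * n + 1) = H.opnorm (V ^ (2 * n + 1))" unfolding \<theta>_def by (rule H.power[symmetric]) simp
      also have "V ^ (2 * n + 1) = smult M (V ^ (2 * n)) - t * V ^ (2 * n)"
        by (rule real_poly_ext) (simp add: V_def algebra_simps)
      also have "H.opnorm \<dots> \<le> H.opnorm (smult M (V ^ (2 * n))) + H.opnorm (t * V ^ (2 * n))"
        by (rule H.diff_le)
      also have "H.opnorm (smult M (V ^ (2 * n))) \<le> M * \<theta> ^ (2 * n)"
        using H.smult_le[of M "V ^ (2 * n)"] M n by (simp add: \<theta>_def H.power)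
      also have "H.opnorm (t * V ^ (2 * n)) \<le> 6 * M ^ (2 * n + 1)"
        using opnorm_eq[OF sah ww] wn[of n] p_st_mult_self by simp
      finally show ?thesis by (simp add: algebra_simps)
    qed
    define r where "r = (\<theta> / M)\<^sup>2"
    have r: "1 < r" using th M by (simp add: r_def)
    obtain n where n: "6 * M / (\<theta> - M) < r ^ n" using real_arch_pow[OF r] by blast
    have "6 * M / (\<theta> - M) < r ^ Suc n"
      using n r by (meson less_trans power_Suc_less_one power_strict_increasing_iff lessI)
    then have "6 * M < (\<theta> / M) ^ (2 * Suc n) * (\<theta> - M)"
      using th by (simp add: r_def divide_less_eq power_mult[symmetric] mult.commute del: power_Suc mult_Suc_right)
    then have "6 * M * M ^ (2 * Suc n) < \<theta> ^ (2 * Suc n) * (\<theta> - M)"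
      using M by (simp add: power_divide field_simps del: power_Suc mult_Suc_right)
    then show False using bound[of "Suc n"] by (simp add: mult_ac)
  qed
  then have "H.pos t" using M by (intro H.posI[of M]) (auto simp: V_def)
  then show ?thesis using nonneg_iff_pos[OF sah evt, of 0] by (simp add: h_def)
qed

text \<open>\<open>p (a + b) - a\<close> is the sum of \<open>p (a + b) - (a + b)\<close> and
  \<open>b\<close>; both are positive, although \<open>a\<close> and \<open>b\<close> need not
  commute.\<close>

theorem positive_mono:
  assumes "positive A a" "positive A b"
  shows "p a \<le> p (a + b)"
proof -
  have a: "nonneg 0 a" "st a = a" and b: "nonneg 0 b"
    using assms nonneg_star_mult_self by (auto simp: positive_def st_mult)
  have "nonneg (p (a + b)) (- (a + b))" by (rule nonneg_of_norm_le) (simp only: p_minus order_refl)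
  from nonneg_add[OF this b] have "nonneg (p (a + b)) (- a)" by simp
  with a show ?thesis by (intro norm_le_of_nonneg) auto
qed

end

section \<open>Hilbert modules\<close>

text \<open>This makes the family of continuous C*-seminorms directed. Sums would not do, since they
  violate the C*-identity in general.\<close>

lemma cstar_seminorm_max:
  assumes p: "cstar_seminorm A p" and q: "cstar_seminorm A q"
  shows "cstar_seminorm A (\<lambda>x. max (p x) (q x))"
  unfolding cstar_seminorm_def
proof (intro conjI allI)
  fix c x y
  show "0 \<le> max (p x) (q x)" using p by (simp add: cstar_seminorm_def le_max_iff_disj)
  have "p (x + y) \<le> p x + p y" "q (x + y) \<le> q x + q y"
    using p q by (simp_all add: cstar_seminorm_def)
  then show "max (p (x + y)) (q (x + y)) \<le> max (p x) (q x) + max (p y) (q y)" by linarith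
  show "max (p (smulA A c x)) (q (smulA A c x)) = cmod c * max (p x) (q x)"
    using p q by (simp add: cstar_seminorm_def max_mult_distrib_left)
  have "p (x * y) \<le> p x * p y" "q (x * y) \<le> q x * q y"
    "p x * p y \<le> max (p x) (q x) * max (p y) (q y)"
    "q x * q y \<le> max (p x) (q x) * max (p y) (q y)"
    using p q by (auto simp: cstar_seminorm_def le_max_iff_disj intro!: mult_mono)
  then show "max (p (x * y)) (q (x * y)) \<le> max (p x) (q x) * max (p y) (q y)" by linarith
  have "p (star A x * x) = (p x)\<^sup>2" "q (star A x * x) = (q x)\<^sup>2" "0 \<le> p x" "0 \<le> q x"
    using p q by (simp_all add: cstar_seminorm_def)
  then show "max (p (star A x * x)) (q (star A x * x)) = (max (p x) (q x))\<^sup>2"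
    by (auto simp: max_def power2_le_iff_abs_le)
qed

locale hilbert =
  fixes A :: "'a::ring pro_alg" and X :: "('a, 'x::ab_group_add) hmod"
  assumes pro: "pro_cstar_algebra A" and hilbert: "hilbert_module A X"
begin

lemma cstar_seminormed: "p \<in> sn A \<Longrightarrow> cstar_seminormed A p"
  using pro by (simp add: pro_cstar_algebra_def cstar_seminormed_def)

text \<open>A nonempty family gives an index for filter bases, and an instance of
  \<open>cstar_seminormed\<close> from which purely algebraic facts are read off.\<close>

lemma zero_in_sn: "(\<lambda>_. 0) \<in> sn A"
proof -
  have "cstar_seminorm A (\<lambda>_. 0)" by (simp add: cstar_seminorm_def)
  moreover have "sn_continuous (sn A) (\<lambda>_. 0)"
    unfolding sn_continuous_def by (intro exI[of _ "{}"]) simp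
  ultimately show ?thesis using pro by (simp add: pro_cstar_algebra_def)
qed

lemma max_in_sn:
  assumes p: "p \<in> sn A" and q: "q \<in> sn A"
  shows "(\<lambda>x. max (p x) (q x)) \<in> sn A"
proof (cases "p = q")
  case False
  have cs: "cstar_seminorm A p" "cstar_seminorm A q"
    using assms pro by (simp_all add: pro_cstar_algebra_def)
  have "max (p x) (q x) \<le> 1 * (\<Sum>r\<in>{p, q}. r x)" for x
    using cs False by (simp add: cstar_seminorm_def)
  then have "sn_continuous (sn A) (\<lambda>x. max (p x) (q x))"
    unfolding sn_continuous_def using assms by (intro exI[of _ "{p, q}"] exI[of _ 1]) simp
  then show ?thesis
    using cstar_seminorm_max[OF cs] pro by (simp add: pro_cstar_algebra_def)
qed (use q in simp)

abbreviation sm where "sm \<equiv> smulX X"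
abbreviation inner where "inner \<equiv> ip X"
abbreviation nm :: "('a \<Rightarrow> real) \<Rightarrow> 'x \<Rightarrow> real" where
  "nm p \<equiv> \<lambda>x. sqrt (p (inner x x))"

lemma
  shows sm_add_right: "sm c (x + y) = sm c x + sm c y"
    and sm_add_left: "sm (c + d) x = sm c x + sm d x"
    and sm_mult: "sm (c * d) x = sm c (sm d x)"
    and sm_one: "sm 1 x = x"
    and act_add_left: "act X (a + b) x = act X a x + act X b x"
    and sm_act: "sm c (act X a x) = act X (smulA A c a) x"
    and inner_add_left: "inner (x + y) z = inner x z + inner y z"
    and inner_sm_left: "inner (sm c x) y = smulA A c (inner x y)"
    and inner_act_left: "inner (act X a x) y = a * inner x y"
    and star_inner: "star A (inner x y) = inner y x"
    and inner_self_positive: "positive A (inner x x)"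
    and inner_self_zero: "inner x x = 0 \<Longrightarrow> x = 0"
    and complete: "sn_complete (hm_norms A X)"
  using hilbert unfolding hilbert_module_def by metis+

lemma sm_zero [simp]: "sm 0 x = 0" "sm c 0 = 0"
  using sm_add_left[of 0 0 x] sm_add_right[of c 0 0] by simp_all

lemma sm_minus_left: "sm (- c) x = - sm c x"
  using sm_add_left[of "- c" c x] by (simp add: eq_neg_iff_add_eq_0)

lemma inner_minus_left: "inner (- x) y = - inner x y"
  using inner_add_left[of "- x" x y] inner_add_left[of 0 0 y] by (simp add: eq_neg_iff_add_eq_0)

lemma inner_diff_left: "inner (x - y) z = inner x z - inner y z"
  using inner_add_left[of x "- y" z] by (simp add: inner_minus_left)

lemma inner_zero_left [simp]: "inner 0 y = 0"
  using inner_add_left[of 0 0 y] by simp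

lemmas star_facts =
  cstar_seminormed.st_add[OF cstar_seminormed[OF zero_in_sn]]
  cstar_seminormed.st_sm[OF cstar_seminormed[OF zero_in_sn]]
  cstar_seminormed.st_mult[OF cstar_seminormed[OF zero_in_sn]]

lemmas smulA_facts =
  cstar_seminormed.mult_sm_left[OF cstar_seminormed[OF zero_in_sn]]
  cstar_seminormed.mult_sm_right[OF cstar_seminormed[OF zero_in_sn]]
  cstar_seminormed.sm_mult[OF cstar_seminormed[OF zero_in_sn]]

lemma inner_add_right: "inner x (y + z) = inner x y + inner x z"
  using arg_cong[OF inner_add_left[of y z x], of "star A"] by (simp only: star_facts star_inner)

lemma inner_sm_right: "inner x (sm c y) = smulA A (cnj c) (inner x y)"
  using arg_cong[OF inner_sm_left[of c y x], of "star A"] by (simp only: star_facts star_inner)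

lemma inner_act_right: "inner x (act X a y) = inner x y * star A a"
  using arg_cong[OF inner_act_left[of a y x], of "star A"] by (simp only: star_facts star_inner)

lemma inner_sm_move: "inner (sm c x) y = inner x (sm (cnj c) y)"
  by (simp add: inner_sm_left inner_sm_right)

lemma inner_minus_right: "inner x (- y) = - inner x y"
  using inner_add_right[of x "- y" y] inner_add_right[of x 0 0] by (simp add: eq_neg_iff_add_eq_0)

lemma inner_diff_right: "inner x (y - z) = inner x y - inner x z"
  using inner_add_right[of x y "- z"] by (simp add: inner_minus_right)

lemma inner_zero_right [simp]: "inner x 0 = 0"
  using inner_add_right[of x 0 0] by simp

lemma positive_sm:
  assumes "positive A a" "0 \<le> r"
  shows "positive A (smulA A (of_real r) a)"
proof -
  obtain b where b: "a = star A b * b" using assms by (auto simp: positive_def)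
  have "complex_of_real r = of_real (sqrt r) * of_real (sqrt r)"
    using assms(2) by (simp flip: of_real_mult)
  then have "smulA A (of_real r) a = star A (smulA A (of_real (sqrt r)) b) * smulA A (of_real (sqrt r)) b"
    by (simp only: b star_facts smulA_facts complex_cnj_complex_of_real)
  then show ?thesis by (auto simp: positive_def)
qed

section \<open>The Cauchy--Schwarz inequality and the module seminorms\<close>

context
  fixes p assumes p: "p \<in> sn A"
begin

interpretation C: cstar_seminormed A p
  by (rule cstar_seminormed[OF p])

lemma nm_nonneg: "0 \<le> nm p x" by simp

lemma nm_square: "(nm p x)\<^sup>2 = p (inner x x)" by simp

text \<open>The discriminant argument for \<open>x - t a y\<close> with
  \<open>a = inner x y\<close>. The cross terms \<open>2 t a a^*\<close> are moved to the other
  side, where monotonicity of \<open>p\<close> drops \<open>inner (x - u) (x - u)\<close>. The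
  scalar inequality that remains is used at \<open>t = 1 / Q\<close>, or at a large \<open>t\<close>
  if \<open>Q = 0\<close>.\<close>

lemma cauchy_schwarz: "p (inner x y) \<le> nm p x * nm p y"
proof -
  define a where "a = inner x y"
  define P where "P = p (inner x x)"
  define Q where "Q = p (inner y y)"
  have PQ: "0 \<le> P" "0 \<le> Q" by (simp_all add: P_def Q_def)
  have key: "2 * t * (p a)\<^sup>2 \<le> P + t\<^sup>2 * (p a)\<^sup>2 * Q" if t: "0 \<le> t" for t
  proof -
    define u where "u = sm (of_real t) (act X a y)"
    have yx: "inner y x = star A a" by (simp add: a_def star_inner)
    have xu: "inner x u = smulA A (of_real t) (a * star A a)"
      by (simp add: u_def inner_sm_right inner_act_right a_def)
    have ux: "inner u x = smulA A (of_real t) (a * star A a)"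
      by (simp add: u_def inner_sm_left inner_act_left yx)
    have uu: "inner u u = smulA A (of_real (t\<^sup>2)) (a * inner y y * star A a)"
      by (simp add: u_def inner_sm_left inner_act_left inner_sm_right inner_act_right
          C.mult_sm_left C.mult_sm_right mult.assoc power2_eq_square C.sm_mult)
    define b where "b = smulA A (of_real (2 * t)) (a * star A a)"
    have "positive A (a * star A a)"
      unfolding positive_def by (intro exI[of _ "star A a"]) simp
    then have posb: "positive A b" unfolding b_def using t by (intro positive_sm) auto
    have b2: "b = smulA A (of_real t) (a * star A a) + smulA A (of_real t) (a * star A a)"
      by (simp add: b_def flip: C.sm_add_left)
    have "b + inner (x - u) (x - u) = inner x x + inner u u"
      by (simp add: inner_diff_left inner_diff_right xu ux b2)
    then have "p b \<le> p (inner x x + inner u u)"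
      using C.positive_mono[OF posb inner_self_positive[of "x - u"]] by simp
    also have "\<dots> \<le> P + p (inner u u)" unfolding P_def by (rule C.p_add)
    also have "p (inner u u) \<le> t\<^sup>2 * (p a * Q * p a)"
    proof -
      have "p (a * inner y y * star A a) \<le> p (a * inner y y) * p (star A a)" by (rule C.p_mult)
      also have "\<dots> \<le> p a * Q * p a"
        unfolding Q_def C.p_st by (intro mult_right_mono C.p_mult C.p_nonneg)
      finally show ?thesis unfolding uu C.p_sm norm_of_real by (simp add: mult_left_mono)
    qed
    finally have "p b \<le> P + t\<^sup>2 * (p a)\<^sup>2 * Q" by (simp add: power2_eq_square mult_ac)
    moreover have "p b = 2 * t * (p a)\<^sup>2"
      using C.p_st_mult_self[of "star A a"] t by (simp add: b_def C.p_sm C.p_st)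
    ultimately show ?thesis by simp
  qed
  have "(p a)\<^sup>2 \<le> P * Q"
  proof (cases "Q = 0")
    case True
    have "(p a)\<^sup>2 = 0"
    proof (rule ccontr)
      assume ne: "(p a)\<^sup>2 \<noteq> 0"
      then have pos: "0 < (p a)\<^sup>2" by simp
      have "2 * ((P + 1) / (p a)\<^sup>2) * (p a)\<^sup>2 \<le> P"
        using key[of "(P + 1) / (p a)\<^sup>2"] pos PQ True by simp
      then show False using ne PQ by simp
    qed
    then show ?thesis using True by simp
  next
    case False
    then have "0 < Q" using PQ by simp
    then show ?thesis using key[of "1 / Q"] by (simp add: field_simps power2_eq_square)
  qed
  then have "p a \<le> sqrt (P * Q)" by (rule real_le_rsqrt)
  then show ?thesis by (simp add: a_def P_def Q_def real_sqrt_mult)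
qed

lemma nm_add: "nm p (x + y) \<le> nm p x + nm p y"
proof -
  have "(nm p (x + y))\<^sup>2 = p ((inner x x + inner x y) + (inner y x + inner y y))"
    by (simp add: inner_add_left inner_add_right add_ac)
  also have "\<dots> \<le> (p (inner x x) + p (inner x y)) + (p (inner y x) + p (inner y y))"
    by (intro order_trans[OF C.p_add] add_mono C.p_add)
  also have "\<dots> \<le> ((nm p x)\<^sup>2 + nm p x * nm p y) + (nm p y * nm p x + (nm p y)\<^sup>2)"
    by (intro add_mono cauchy_schwarz) simp_all
  also have "\<dots> = (nm p x + nm p y)\<^sup>2" by (simp add: power2_eq_square algebra_simps)
  finally show ?thesis by (rule power2_le_imp_le) simp
qed

lemma nm_sm: "nm p (sm c x) = cmod c * nm p x"
proof -
  have "inner (sm c x) (sm c x) = smulA A (c * cnj c) (inner x x)"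
    by (simp only: inner_sm_left inner_sm_right C.sm_mult[symmetric] mult.commute[of c "cnj c"])
  then show ?thesis
    by (simp add: C.p_sm norm_mult real_sqrt_mult)
qed

lemma nm_minus: "nm p (- x) = nm p x"
  using nm_sm[of "- 1" x] by (simp add: sm_minus_left sm_one)

lemma nm_minus_commute: "nm p (x - y) = nm p (y - x)"
  using nm_minus[of "x - y"] by simp

lemma nm_diff: "nm p (x - y) \<le> nm p x + nm p y"
  using nm_add[of x "- y"] by (simp add: nm_minus)

lemma nm_triangle: "nm p (x - z) \<le> nm p (x - y) + nm p (y - z)"
  using nm_add[of "x - y" "y - z"] by simp

lemma nm_act: "nm p (act X a x) \<le> p a * nm p x"
proof -
  have "(nm p (act X a x))\<^sup>2 = p (a * inner x x * star A a)"
    by (simp add: inner_act_left inner_act_right mult.assoc)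
  also have "\<dots> \<le> p (a * inner x x) * p (star A a)" by (rule C.p_mult)
  also have "\<dots> \<le> (p a * p (inner x x)) * p a"
    unfolding C.p_st by (intro mult_right_mono C.p_mult C.p_nonneg)
  also have "\<dots> = (p a * nm p x)\<^sup>2" by (simp add: power_mult_distrib power2_eq_square mult_ac)
  finally show ?thesis by (rule power2_le_imp_le) simp
qed

text \<open>Pairing with \<open>x\<close> gives a sum of two positive elements; \<open>p\<close> may
  drop \<open>inner y x\<close>, and Cauchy--Schwarz accounts for the extra factor
  \<open>nm p x\<close>.\<close>

lemma accretive_norm_le:
  assumes c: "0 \<le> c" and y: "positive A (inner y x)"
  shows "c * nm p x \<le> nm p (sm (of_real c) x + y)"
proof (cases "nm p x = 0")
  case False
  have "c * (nm p x)\<^sup>2 = p (smulA A (of_real c) (inner x x))" using c by (simp add: C.p_sm)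
  also have "\<dots> \<le> p (smulA A (of_real c) (inner x x) + inner y x)"
    using c y by (intro C.positive_mono positive_sm inner_self_positive)
  also have "\<dots> = p (inner (sm (of_real c) x + y) x)" by (simp add: inner_add_left inner_sm_left)
  also have "\<dots> \<le> nm p (sm (of_real c) x + y) * nm p x" by (rule cauchy_schwarz)
  finally have "(c * nm p x) * nm p x \<le> nm p (sm (of_real c) x + y) * nm p x"
    by (simp only: power2_eq_square mult.assoc)
  moreover have "0 < nm p x" using False nm_nonneg[of x] by linarith
  ultimately show ?thesis by (rule mult_right_le_imp_le)
next
  case True
  show ?thesis unfolding True by simp
qed

end

section \<open>Limits and operator equations in closed submodules\<close>

lemma eq_zero_if_norms_zero:
  assumes "\<And>p. p \<in> sn A \<Longrightarrow> nm p x = 0"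
  shows "x = 0"
proof -
  have "p (inner x x) = 0" if "p \<in> sn A" for p using assms[OF that] by simp
  then have "inner x x = 0" using pro by (auto simp: pro_cstar_algebra_def sn_hausdorff_def)
  then show ?thesis by (rule inner_self_zero)
qed

lemma hm_norms_eq: "hm_norms A X = nm ` sn A"
  by (auto simp: hm_norms_def)

lemma closed_complete:
  assumes F: "F \<noteq> bot" and cauchy: "sn_cauchy (hm_norms A X) F"
    and R: "eventually (\<lambda>y. y \<in> R) F" and closed: "sn_closed (hm_norms A X) R"
  shows "\<exists>x\<in>R. \<forall>p\<in>sn A. \<forall>e>0. eventually (\<lambda>y. nm p (y - x) < e) F"
proof -
  obtain x where x: "sn_converges (hm_norms A X) F x"
    using complete F cauchy by (auto simp: sn_complete_def)
  have ev: "eventually (\<lambda>y. nm p (y - x) < e) F" if "p \<in> sn A" "0 < e" for p e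
    using x that by (auto simp: sn_converges_def hm_norms_eq)
  have "x \<in> R"
  proof (rule closed[unfolded sn_closed_def, rule_format])
    fix G and e :: real assume G: "G \<subseteq> hm_norms A X \<and> finite G" and e: "0 < e"
    have "eventually (\<lambda>y. \<forall>q\<in>G. q (x - y) < e) F"
    proof (rule eventually_ball_finite)
      show "\<forall>q\<in>G. eventually (\<lambda>y. q (x - y) < e) F"
      proof
        fix q assume "q \<in> G"
        then obtain p where p: "p \<in> sn A" "q = nm p" using G by (auto simp: hm_norms_eq)
        show "eventually (\<lambda>y. q (x - y) < e) F"
          using ev[OF p(1) e] unfolding p(2) by (subst nm_minus_commute[OF p(1)])
      qed
    qed (use G in simp)
    then have "\<exists>y. y \<in> R \<and> (\<forall>q\<in>G. q (x - y) < e)"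
      using R F by (intro eventually_happens'[of F] eventually_conj) auto
    then show "\<exists>c\<in>R. \<forall>p\<in>G. p (x - c) < e" by blast
  qed
  then show ?thesis using ev by blast
qed

lemma submodule_minus: "submodule X R \<Longrightarrow> x \<in> R \<Longrightarrow> - x \<in> R"
  using sm_minus_left[of 1 x] by (metis sm_one submodule_def)

lemma submodule_diff: "submodule X R \<Longrightarrow> x \<in> R \<Longrightarrow> y \<in> R \<Longrightarrow> x - y \<in> R"
  using submodule_minus[of R y] by (metis diff_conv_add_uminus submodule_def)

lemma dense_range_on_submodule:
  assumes R: "submodule X R"
    and D_add: "\<And>x y. D (x + y) = D x + D y" and D_sm: "\<And>c x. D (sm c x) = sm c (D x)"
    and D_R: "\<And>x. x \<in> R \<Longrightarrow> D x \<in> R"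
    and sa: "\<And>x y. inner (D x) y = inner x (D y)"
    and pos: "\<And>x. positive A (inner (D x) x)"
    and p: "p \<in> sn A" and bounded: "\<exists>K. \<forall>x. nm p (D x) \<le> K * nm p x"
    and c: "0 \<le> c"
    and d: "0 < d" and below: "\<And>x. x \<in> R \<Longrightarrow> d * nm p x \<le> nm p (sm (of_real c) x + D x)"
    and z: "z \<in> R" and e: "0 < e"
  shows "\<exists>u\<in>R. nm p (sm (of_real c) u + D u - z) < e"
proof -
  interpret C: cstar_seminormed A p by (rule cstar_seminormed[OF p])
  interpret O: selfadjoint_operator sm R "nm p" inner p D
  proof
    show "\<exists>K. \<forall>x\<in>R. nm p (D x) \<le> K * nm p x" using bounded by blast
    show "nm p (x + y) \<le> nm p x + nm p y" for x y by (rule nm_add[OF p])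
    show "nm p (sm c x) = cmod c * nm p x" for c x by (rule nm_sm[OF p])
    show "p (inner x y) \<le> nm p x * nm p y" for x y by (rule cauchy_schwarz[OF p])
    show "inner (sm c x) y = inner x (sm (cnj c) y)" for c x y by (rule inner_sm_move)
  qed (use R in \<open>auto simp: sm_add_right sm_add_left sm_mult sm_one D_add D_sm D_R sa
      inner_add_left inner_add_right submodule_def\<close>)
  have "nm p x \<le> nm p (x + sm (of_real e) (D x))" if "0 < e" for e x
  proof -
    have "positive A (inner (sm (of_real e) (D x)) x)"
      unfolding inner_sm_left using that pos by (intro positive_sm) auto
    then show ?thesis
      using accretive_norm_le[OF p, of 1 "sm (of_real e) (D x)" x] by (simp add: sm_one)
  qed
  then have "O.pos [:0, 1:]" by (intro O.pos_of_accretive)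
  then have "O.pos ([:c:] + [:0, 1:])" using c by (intro O.pos_add O.pos_const)
  then have "O.pos [:c, 1:]" by simp
  moreover have ev: "O.ev [:c, 1:] x = sm (of_real c) x + D x" for x by (simp add: sm_one)
  ultimately show ?thesis
    using O.pos_bounded_below_dense_range[OF _ d _ z e, of "[:c, 1:]"] below by (simp only: ev)
qed

text \<open>Maxima of seminorms and minima of radii make the sets \<open>S b\<close> a filter base,
  although the lower bound varies with the seminorm. That bound turns small residuals into small
  differences. The shift \<open>c\<close> is positive for truncations and \<open>0\<close> for the
  final inversion.\<close>

lemma surjective_on_closed_submodule:
  assumes R: "submodule X R" and closed: "sn_closed (hm_norms A X) R"
    and D_add: "\<And>x y. D (x + y) = D x + D y" and D_sm: "\<And>c x. D (sm c x) = sm c (D x)"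
    and D_R: "\<And>x. x \<in> R \<Longrightarrow> D x \<in> R"
    and sa: "\<And>x y. inner (D x) y = inner x (D y)"
    and pos: "\<And>x. positive A (inner (D x) x)"
    and bounded: "\<And>p. p \<in> sn A \<Longrightarrow> \<exists>K. \<forall>x. nm p (D x) \<le> K * nm p x"
    and c: "0 \<le> c"
    and below: "\<And>p. p \<in> sn A \<Longrightarrow> \<exists>d>0. \<forall>x\<in>R. d * nm p x \<le> nm p (sm (of_real c) x + D x)"
    and z: "z \<in> R"
  shows "\<exists>u\<in>R. sm (of_real c) u + D u = z"
proof -
  define E where "E x = sm (of_real c) x + D x" for x
  have E_diff: "E (x - y) = E x - E y" for x y
  proof -
    have "E (x - y) + E y = E x" unfolding E_def using sm_add_right[of "of_real c" "x - y" y] D_add[of "x - y" y]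
      by (simp add: algebra_simps)
    then show ?thesis by (simp add: algebra_simps)
  qed
  define I where "I = sn A \<times> {0::real<..}"
  define S where "S b = {u \<in> R. nm (fst b) (E u - z) < snd b}" for b
  define F where "F = (INF b\<in>I. principal (S b))"
  have base: "eventually P F \<longleftrightarrow> (\<exists>b\<in>I. \<forall>u\<in>S b. P u)" for P
  proof -
    have "eventually P F \<longleftrightarrow> (\<exists>b\<in>I. eventually P (principal (S b)))"
      unfolding F_def
    proof (rule eventually_INF_base)
      show "I \<noteq> {}" using zero_in_sn by (auto simp: I_def intro: exI[of _ 1])
      fix a b assume ab: "a \<in> I" "b \<in> I"
      define m where "m = (\<lambda>x. max (fst a x) (fst b x), min (snd a) (snd b))"
      have "m \<in> I" using ab max_in_sn by (auto simp: I_def m_def)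
      moreover have "nm (fst a) x \<le> nm (fst m) x" "nm (fst b) x \<le> nm (fst m) x" for x
        unfolding m_def fst_conv by (intro real_sqrt_le_mono max.cobounded1 max.cobounded2)+
      moreover have "snd m \<le> snd a" "snd m \<le> snd b" by (simp_all add: m_def)
      ultimately have "S m \<subseteq> S a \<inter> S b" "m \<in> I"
        unfolding S_def by (blast intro: le_less_trans less_le_trans)+
      then show "\<exists>x\<in>I. principal (S x) \<le> inf (principal (S a)) (principal (S b))"
        by (intro bexI[of _ m]) auto
    qed
    then show ?thesis by (simp add: eventually_principal)
  qed
  have small: "eventually (\<lambda>u. u \<in> R \<and> nm p (E u - z) < e) F" if "p \<in> sn A" "0 < e" for p e
    unfolding base using that by (intro bexI[of _ "(p, e)"]) (auto simp: I_def S_def)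
  have "F \<noteq> bot"
  proof
    assume "F = bot"
    then have "eventually (\<lambda>_. False) F" by simp
    then obtain p e where p: "p \<in> sn A" "0 < e" and empty: "S (p, e) = {}"
      by (auto simp: base I_def)
    obtain d where "0 < d" "\<And>x. x \<in> R \<Longrightarrow> d * nm p x \<le> nm p (E x)"
      using below[OF p(1)] by (auto simp: E_def)
    then have "\<exists>u\<in>R. nm p (E u - z) < e" unfolding E_def
      using dense_range_on_submodule[OF R D_add D_sm D_R sa pos p(1) bounded[OF p(1)] c _ _ z p(2)]
      by blast
    then show False using empty by (auto simp: S_def)
  qed
  moreover have "sn_cauchy (hm_norms A X) F"
    unfolding sn_cauchy_def hm_norms_eq
  proof (intro ballI allI impI)
    fix q and e :: real assume "q \<in> nm ` sn A" and e: "0 < e"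
    then obtain p where p: "p \<in> sn A" and q: "q = nm p" by blast
    obtain d where d: "0 < d" "\<And>x. x \<in> R \<Longrightarrow> d * nm p x \<le> nm p (E x)"
      using below[OF p] by (auto simp: E_def)
    have "0 < d * e / 2" using d e by simp
    note small[OF p this]
    from eventually_prodI[OF this this]
    have "eventually (\<lambda>(x, y). (x \<in> R \<and> nm p (E x - z) < d * e / 2) \<and> (y \<in> R \<and> nm p (E y - z) < d * e / 2))
        (F \<times>\<^sub>F F)"
      by (simp only: case_prod_unfold)
    then show "eventually (\<lambda>(x, y). q (x - y) < e) (F \<times>\<^sub>F F)"
    proof eventually_elim
      case (elim xy)
      obtain x y where xy: "xy = (x, y)" by fastforce
      have x: "x \<in> R" "nm p (E x - z) < d * e / 2" and y: "y \<in> R" "nm p (E y - z) < d * e / 2"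
        using elim by (auto simp: xy)
      have "d * nm p (x - y) \<le> nm p (E x - E y)"
        using d(2)[OF submodule_diff[OF R x(1) y(1)]] by (simp only: E_diff)
      also have "\<dots> \<le> nm p (E x - z) + nm p (E y - z)"
        using nm_triangle[OF p, of "E x" "E y" z] nm_minus_commute[OF p, of z "E y"] by simp
      also have "\<dots> < d * e" using x(2) y(2) by simp
      finally show ?case using d(1) by (simp add: xy q)
    qed
  qed
  moreover have "eventually (\<lambda>u. u \<in> R) F"
    using small[OF zero_in_sn, of 1] by (auto elim: eventually_mono)
  ultimately obtain u where u: "u \<in> R" "\<And>p e. p \<in> sn A \<Longrightarrow> 0 < e \<Longrightarrow> eventually (\<lambda>y. nm p (y - u) < e) F"
    using closed_complete[OF _ _ _ closed, of F] by blast
  have "E u - z = 0"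
  proof (rule eq_zero_if_norms_zero)
    fix p assume p: "p \<in> sn A"
    interpret C: cstar_seminormed A p by (rule cstar_seminormed[OF p])
    obtain K where K: "\<And>x. nm p (D x) \<le> K * nm p x" using bounded[OF p] by blast
    have EK: "nm p (E x) \<le> (c + \<bar>K\<bar>) * nm p x" for x
    proof -
      have "nm p (E x) \<le> nm p (sm (of_real c) x) + nm p (D x)" unfolding E_def by (rule nm_add[OF p])
      also have "\<dots> \<le> c * nm p x + \<bar>K\<bar> * nm p x"
        using K[of x] mult_right_mono[OF abs_ge_self[of K] nm_nonneg[OF p, of x]] c
        by (simp add: nm_sm[OF p])
      finally show ?thesis by (simp only: distrib_right)
    qed
    have "nm p (E u - z) \<le> 0"
    proof (rule le_of_le_add_mult_eps[where c = "c + \<bar>K\<bar> + 1"])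
      fix e :: real assume e: "0 < e" "e \<le> 1"
      have "eventually (\<lambda>y. nm p (y - u) < e \<and> (y \<in> R \<and> nm p (E y - z) < e)) F"
        by (intro eventually_conj u(2) small p e)
      then obtain y where y: "nm p (y - u) < e" "nm p (E y - z) < e"
        using eventually_happens'[OF \<open>F \<noteq> bot\<close>] by blast
      have "nm p (E u - z) \<le> nm p (E (u - y)) + nm p (E y - z)"
        using nm_triangle[OF p, of "E u" z "E y"] by (simp only: E_diff)
      also have "\<dots> \<le> (c + \<bar>K\<bar>) * nm p (u - y) + e" using EK[of "u - y"] y by simp
      also have "\<dots> \<le> (c + \<bar>K\<bar>) * e + e"
        using y(1) c nm_minus_commute[OF p, of u y] by (intro add_right_mono mult_left_mono) auto
      finally show "nm p (E u - z) \<le> 0 + (c + \<bar>K\<bar> + 1) * e" by (simp add: algebra_simps)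
    qed (use c in simp)
    then show "nm p (E u - z) = 0" using nm_nonneg[OF p, of "E u - z"] by (rule antisym)
  qed
  then show ?thesis using u(1) by (auto simp: E_def)
qed

text \<open>The witness is \<open>z = c(c + a)\<^sup>-\<^sup>1w\<close> with \<open>a = \<langle>w, w\<rangle>\<close> and \<open>c = p(a)\<close>.\<close>

lemma bounded_truncation:
  assumes R: "submodule X R" and closed: "sn_closed (hm_norms A X) R"
    and w: "w \<in> R" and p: "p \<in> sn A" and w0: "0 < nm p w"
  shows "\<exists>z\<in>R. (\<forall>q\<in>sn A. nm q z \<le> nm p w) \<and> (nm p w)\<^sup>2 \<le> 2 * p (inner z w)"
proof -
  define c where "c = (nm p w)\<^sup>2"
  have c: "0 < c" unfolding c_def using w0 by (rule zero_less_power)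
  \<comment> \<open>Solving with this rank-one operator replaces the inverse of
    \<open>c + inner w w\<close> in a unitization.\<close>
  define D where "D v = act X (inner v w) w" for v
  have pos: "positive A (inner (D v) v)" for v
    unfolding D_def inner_act_left positive_def by (intro exI[of _ "inner w v"]) (simp add: star_inner)
  have "\<exists>u\<in>R. sm (of_real c) u + D u = sm (of_real c) w"
  proof (rule surjective_on_closed_submodule[OF R closed])
    show "D (x + y) = D x + D y" for x y by (simp add: D_def inner_add_left act_add_left)
    show "D (sm k x) = sm k (D x)" for k x by (simp add: D_def inner_sm_left sm_act)
    show "D x \<in> R" for x using R w by (auto simp: D_def submodule_def)
    show "inner (D x) y = inner x (D y)" for x y
      by (simp add: D_def inner_act_left inner_act_right star_inner)
    show "positive A (inner (D x) x)" for x by (rule pos)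
    fix q assume q: "q \<in> sn A"
    interpret Q: cstar_seminormed A q by (rule cstar_seminormed[OF q])
    have "nm q (D x) \<le> (nm q w * nm q w) * nm q x" for x
    proof -
      have "nm q (D x) \<le> q (inner x w) * nm q w" unfolding D_def by (rule nm_act[OF q])
      also have "\<dots> \<le> (nm q x * nm q w) * nm q w"
        by (intro mult_right_mono cauchy_schwarz q nm_nonneg)
      finally show ?thesis by (simp only: mult_ac)
    qed
    then show "\<exists>K. \<forall>x. nm q (D x) \<le> K * nm q x" by blast
    show "\<exists>d>0. \<forall>x\<in>R. d * nm q x \<le> nm q (sm (of_real c) x + D x)"
      using accretive_norm_le[OF q _ pos] c by (intro exI[of _ c]) auto
  qed (use c R w in \<open>auto simp: submodule_def\<close>)
  then obtain z where zR: "z \<in> R" and z: "sm (of_real c) z + D z = sm (of_real c) w" by blast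
  have "nm q z \<le> nm p w" if q: "q \<in> sn A" for q
  proof -
    interpret Q: cstar_seminormed A q by (rule cstar_seminormed[OF q])
    define g where "g = inner w z"
    \<comment> \<open>The equation paired with \<open>z\<close>. Either positive summand may be
      dropped under any \<open>q\<close>, and \<open>c\<close> enters only as a scalar; hence the
      bound is uniform in \<open>q\<close>.\<close>
    have eq: "smulA A (of_real c) (inner z z) + star A g * g = smulA A (of_real c) g"
      using arg_cong[OF z, of "\<lambda>v. inner v z"]
      by (simp add: inner_add_left inner_sm_left D_def inner_act_left g_def star_inner)
    have pz: "positive A (smulA A (of_real c) (inner z z))"
      using c by (intro positive_sm inner_self_positive) auto
    have pg: "positive A (star A g * g)" by (auto simp: positive_def)
    have "c * q (inner z z) \<le> c * q g"
      using Q.positive_mono[OF pz pg] c unfolding eq by (simp add: Q.p_sm)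
    then have 1: "q (inner z z) \<le> q g" using c by simp
    have "(q g)\<^sup>2 \<le> c * q g"
      using Q.positive_mono[OF pg pz] c eq by (simp add: Q.p_sm Q.p_st_mult_self add.commute)
    then have "q g \<le> c" using c Q.p_nonneg[of g]
      by (cases "q g = 0") (auto simp: power2_eq_square)
    with 1 have "q (inner z z) \<le> (nm p w)\<^sup>2" by (simp add: c_def)
    then have "nm q z \<le> sqrt ((nm p w)\<^sup>2)" by (rule real_sqrt_le_mono)
    then show ?thesis using w0 by simp
  qed
  moreover have "(nm p w)\<^sup>2 \<le> 2 * p (inner z w)"
  proof -
    interpret P: cstar_seminormed A p by (rule cstar_seminormed[OF p])
    have pw: "p (inner w w) = c" by (simp add: c_def)
    \<comment> \<open>The equation paired with \<open>w\<close>. As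
      \<open>p (inner w w) = c\<close>, each summand on the left has \<open>p\<close>-value at most
      \<open>c * p (inner z w)\<close>; this is the factor \<open>2\<close>.\<close>
    have eq: "smulA A (of_real c) (inner z w) + inner z w * inner w w = smulA A (of_real c) (inner w w)"
      using arg_cong[OF z, of "\<lambda>v. inner v w"]
      by (simp add: inner_add_left inner_sm_left D_def inner_act_left)
    have "c * c = p (smulA A (of_real c) (inner z w) + inner z w * inner w w)"
      unfolding eq using c pw by (simp add: P.p_sm)
    also have "\<dots> \<le> p (smulA A (of_real c) (inner z w)) + p (inner z w * inner w w)" by (rule P.p_add)
    also have "\<dots> \<le> c * p (inner z w) + p (inner z w) * c"
      using P.p_mult[of "inner z w" "inner w w"] c pw by (simp add: P.p_sm mult.commute)
    finally have "c * c \<le> c * (2 * p (inner z w))" by simp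
    then show ?thesis using c by (simp add: c_def[symmetric])
  qed
  ultimately show ?thesis using zR by blast
qed

lemma limit_in_closed_set:
  assumes closed: "sn_closed (hm_norms A X) R" and R: "\<And>n. y n \<in> R"
    and cauchy: "\<And>p. p \<in> sn A \<Longrightarrow> \<forall>n m. n \<le> m \<longrightarrow> nm p (y m - y n) \<le> b n"
    and b: "b \<longlonglongrightarrow> 0"
  shows "\<exists>l\<in>R. \<forall>p\<in>sn A. \<forall>n. nm p (l - y n) \<le> b n"
proof -
  have "sn_cauchy (hm_norms A X) (filtermap y sequentially)"
    unfolding sn_cauchy_def hm_norms_eq
  proof (intro ballI allI impI)
    fix q and e :: real assume "q \<in> nm ` sn A" and e: "0 < e"
    then obtain p where p: "p \<in> sn A" and q: "q = nm p" by blast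
    obtain N where N: "b N < e / 2"
      using order_tendstoD(2)[OF b, of "e / 2"] e by (auto simp: eventually_sequentially)
    have "nm p (y m - y n) < e" if "N \<le> m" "N \<le> n" for m n
    proof -
      have "nm p (y m - y n) \<le> nm p (y m - y N) + nm p (y n - y N)"
        using nm_triangle[OF p, of "y m" "y n" "y N"] nm_minus_commute[OF p, of "y N" "y n"] by simp
      then show ?thesis using cauchy[OF p] that N by (smt (verit) field_sum_of_halves)
    qed
    then have "\<forall>xy\<in>y ` {N..} \<times> y ` {N..}. nm p (fst xy - snd xy) < e" by auto
    moreover have "eventually (\<lambda>x. x \<in> y ` {N..}) (filtermap y sequentially)"
      by (auto simp: eventually_filtermap eventually_sequentially)
    ultimately show "eventually (\<lambda>(x, y). q (x - y) < e) (filtermap y sequentially \<times>\<^sub>F filtermap y sequentially)"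
      unfolding q eventually_prod_filter
      by (intro exI[of _ "\<lambda>x. x \<in> y ` {N..}"]) auto
  qed
  moreover have "filtermap y sequentially \<noteq> bot" by (simp add: filtermap_bot_iff)
  moreover have "eventually (\<lambda>x. x \<in> R) (filtermap y sequentially)" by (simp add: eventually_filtermap R)
  ultimately obtain l where l: "l \<in> R"
    "\<And>p e. p \<in> sn A \<Longrightarrow> 0 < e \<Longrightarrow> eventually (\<lambda>n. nm p (y n - l) < e) sequentially"
    using closed_complete[OF _ _ _ closed, of "filtermap y sequentially"]
    unfolding eventually_filtermap by blast
  have "nm p (l - y n) \<le> b n" if p: "p \<in> sn A" for p n
  proof (rule le_of_le_add_mult_eps[where c = 1])
    fix e :: real assume "0 < e"
    then obtain M where M: "\<And>k. M \<le> k \<Longrightarrow> nm p (y k - l) < e"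
      using l(2)[OF p] unfolding eventually_sequentially by blast
    define k where "k = max M n"
    have "nm p (l - y n) \<le> nm p (y k - l) + nm p (y k - y n)"
      using nm_triangle[OF p, of l "y n" "y k"] nm_minus_commute[OF p, of l "y k"] by simp
    moreover have "nm p (y k - l) < e" "nm p (y k - y n) \<le> b n"
      using M[of k] cauchy[OF p] by (simp_all add: k_def)
    ultimately show "nm p (l - y n) \<le> b n + 1 * e" by simp
  qed simp
  then show ?thesis using l(1) by blast
qed

text \<open>Uniform boundedness by a gliding hump: if the bound fails, choose \<open>w n\<close> with \<open>f (w n) \<le> 1\<close>
  and norm \<open>(n + 1) 5\<^sup>n\<close>; a suitably signed sum of truncations of \<open>5\<^sup>-\<^sup>nw n / \<parallel>w n\<parallel>\<close>, which converges
  for all seminorms at once, has unbounded inner products with the \<open>w n\<close>.\<close>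

lemma uniform_lower_bound:
  assumes R: "submodule X R" and closed: "sn_closed (hm_norms A X) R" and p: "p \<in> sn A"
    and f_nonneg: "\<And>w. 0 \<le> f w"
    and f_sm: "\<And>r w. 0 \<le> r \<Longrightarrow> f (sm (of_real r) w) = r * f w"
    and pointwise: "\<And>y. y \<in> R \<Longrightarrow> \<exists>C. \<forall>w. p (inner y w) \<le> C * f w"
  shows "\<exists>d>0. \<forall>w\<in>R. d * nm p w \<le> f w"
proof (rule ccontr)
  assume contra: "\<not> (\<exists>d>0. \<forall>w\<in>R. d * nm p w \<le> f w)"
  interpret C: cstar_seminormed A p by (rule cstar_seminormed[OF p])
  \<comment> \<open>With base \<open>5\<close> the tail beyond stage \<open>n\<close> pairs with
    \<open>w n\<close> to at most \<open>(n + 1) / 4\<close>, against a main term of at least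
    \<open>(n + 1) / 2\<close>.\<close>
  define N :: "nat \<Rightarrow> real" where "N n = (real n + 1) * 5 ^ n" for n
  have N: "0 < N n" for n by (simp add: N_def)
  have "\<exists>w\<in>R. f w \<le> 1 \<and> nm p w = N n" for n
  proof -
    obtain v where v: "v \<in> R" "f v < 1 / N n * nm p v"
      using contra[unfolded not_ex, rule_format, of "1 / N n"] N[of n] by (auto simp: not_le)
    have v0: "0 < nm p v"
    proof (rule ccontr)
      assume "\<not> 0 < nm p v"
      then have "nm p v = 0" using nm_nonneg[OF p, of v] by linarith
      then show False using v(2) f_nonneg[of v] by (simp only:)
    qed
    define r where "r = N n / nm p v"
    have r: "0 < r" using v0 N[of n] unfolding r_def by (rule_tac divide_pos_pos)
    have "f (sm (of_real r) v) = r * f v" using r by (simp add: f_sm)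
    also have "\<dots> \<le> r * (1 / N n * nm p v)" using v(2) r by (intro mult_left_mono) auto
    also have "\<dots> = 1" unfolding r_def using v0 N[of n] by (simp add: field_simps)
    finally have "f (sm (of_real r) v) \<le> 1" .
    moreover have "nm p (sm (of_real r) v) = N n"
      unfolding nm_sm[OF p] norm_of_real using r v0 N[of n] by (simp add: r_def)
    ultimately show ?thesis using v(1) R by (auto simp: submodule_def)
  qed
  then obtain w where w: "\<And>n. w n \<in> R" "\<And>n. f (w n) \<le> 1" "\<And>n. nm p (w n) = N n" by metis
  have "\<exists>z\<in>R. (\<forall>q\<in>sn A. nm q z \<le> N n) \<and> (N n)\<^sup>2 \<le> 2 * p (inner z (w n))" for n
    using bounded_truncation[OF R closed w(1)[of n] p] N[of n] unfolding w(3) by blast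
  then obtain z where z: "\<And>n. z n \<in> R" "\<And>n q. q \<in> sn A \<Longrightarrow> nm q (z n) \<le> N n"
    "\<And>n. (N n)\<^sup>2 \<le> 2 * p (inner (z n) (w n))" by metis
  define u where "u n = sm (of_real (1 / (N n * 5 ^ n))) (z n)" for n
  have uR: "u n \<in> R" for n using z(1) R by (auto simp: u_def submodule_def)
  have unm: "nm q (u n) \<le> (1/5) ^ n" if q: "q \<in> sn A" for q n
  proof -
    have "nm q (u n) = 1 / (N n * 5 ^ n) * nm q (z n)"
      unfolding u_def nm_sm[OF q] norm_of_real using N[of n] by simp
    also have "\<dots> \<le> 1 / (N n * 5 ^ n) * N n"
      using z(2)[OF q, of n] N[of n] by (intro mult_left_mono) auto
    also have "\<dots> = (1/5) ^ n" using N[of n] by (simp add: power_divide)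
    finally show ?thesis .
  qed
  have uw: "(real n + 1) / 2 \<le> p (inner (u n) (w n))" for n
  proof -
    have "p (inner (u n) (w n)) = 1 / (N n * 5 ^ n) * p (inner (z n) (w n))"
      unfolding u_def inner_sm_left C.p_sm norm_of_real using N[of n] by simp
    moreover have "1 / (N n * 5 ^ n) * ((N n)\<^sup>2 / 2) \<le> 1 / (N n * 5 ^ n) * p (inner (z n) (w n))"
      using z(3)[of n] N[of n] by (intro mult_left_mono) auto
    moreover have "1 / (N n * 5 ^ n) * ((N n)\<^sup>2 / 2) = (real n + 1) / 2"
      unfolding power2_eq_square using N[of n] by (simp add: N_def)
    ultimately show ?thesis by (simp only:)
  qed
  \<comment> \<open>Since \<open>2 a = (b + a) - (b - a)\<close>, one of the two signs gives at
    least \<open>p a\<close>; earlier terms thus cannot cancel the new one.\<close>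
  define y where "y = rec_nat (0::'x) (\<lambda>n y. if p (inner (u n) (w n)) \<le> p (inner (y + u n) (w n))
    then y + u n else y - u n)"
  have y0: "y 0 = 0" and yS: "y (Suc n) = (if p (inner (u n) (w n)) \<le> p (inner (y n + u n) (w n))
    then y n + u n else y n - u n)" for n by (simp_all add: y_def)
  have yw: "p (inner (u n) (w n)) \<le> p (inner (y (Suc n)) (w n))" for n
  proof -
    define a where "a = inner (u n) (w n)"
    define b where "b = inner (y n) (w n)"
    have "(b + a) - (b - a) = smulA A 2 a"
      using C.sm_add_left[of 1 1 a] by (simp add: C.sm_one)
    then have "2 * p a \<le> p (b + a) + p (b - a)"
      using C.p_add[of "b + a" "- (b - a)"] C.p_sm[of 2 a] C.p_minus[of "b - a"] by simp
    then show ?thesis by (auto simp: yS inner_add_left inner_diff_left a_def b_def)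
  qed
  have yR: "y n \<in> R" for n
  proof (induction n)
    case (Suc n)
    then show ?case using uR[of n] R submodule_diff[OF R] by (auto simp: yS submodule_def)
  qed (use R in \<open>simp add: y0 submodule_def\<close>)
  have step: "nm q (y (Suc n) - y n) \<le> (1/5) ^ n" if q: "q \<in> sn A" for q n
    using unm[OF q, of n] nm_minus[OF q, of "u n"] by (simp add: yS)
  have tail: "nm q (y (n + j) - y n) \<le> 5/4 * ((1/5) ^ n - (1/5) ^ (n + j))" if q: "q \<in> sn A" for q n j
  proof (induction j)
    case 0
    have "nm q 0 = 0" using nm_sm[OF q, of 0 0] by simp
    then show ?case by simp
  next
    case (Suc j)
    have "nm q (y (n + Suc j) - y n) \<le> nm q (y (Suc (n + j)) - y (n + j)) + nm q (y (n + j) - y n)"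
      using nm_triangle[OF q, of "y (n + Suc j)" "y n" "y (n + j)"] by simp
    also have "\<dots> \<le> (1/5) ^ (n + j) + 5/4 * ((1/5) ^ n - (1/5) ^ (n + j))"
      by (intro add_mono step[OF q] Suc)
    also have "\<dots> = 5/4 * ((1/5) ^ n - (1/5) ^ (n + Suc j))" by (simp add: diff_divide_distrib)
    finally show ?case .
  qed
  have "\<exists>l\<in>R. \<forall>q\<in>sn A. \<forall>n. nm q (l - y n) \<le> 5/4 * (1/5) ^ n"
  proof (rule limit_in_closed_set[OF closed yR])
    show "(\<lambda>n. 5/4 * (1/5::real) ^ n) \<longlonglongrightarrow> 0"
      by (intro tendsto_mult_right_zero LIMSEQ_power_zero) simp
    fix q assume q: "q \<in> sn A"
    show "\<forall>n m. n \<le> m \<longrightarrow> nm q (y m - y n) \<le> 5/4 * (1/5) ^ n"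
    proof (intro allI impI)
      fix n m :: nat assume "n \<le> m"
      then have "nm q (y m - y n) \<le> 5/4 * ((1/5) ^ n - (1/5) ^ m)" using tail[OF q, of n "m - n"] by simp
      also have "\<dots> \<le> 5/4 * (1/5) ^ n" by simp
      finally show "nm q (y m - y n) \<le> 5/4 * (1/5) ^ n" .
    qed
  qed
  then obtain l where l: "l \<in> R" "\<And>n. nm p (l - y n) \<le> 5/4 * (1/5) ^ n" using p by blast
  obtain K where K: "\<And>w. p (inner l w) \<le> K * f w" using pointwise[OF l(1)] by blast
  have growth: "(real n + 1) / 4 \<le> \<bar>K\<bar>" for n
  proof -
    have "p (inner (y (Suc n) - l) (w n)) \<le> nm p (y (Suc n) - l) * nm p (w n)" by (rule cauchy_schwarz[OF p])
    also have "\<dots> \<le> 5/4 * (1/5) ^ Suc n * N n"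
      unfolding w(3) using l(2)[of "Suc n"] N[of n] nm_minus_commute[OF p, of l "y (Suc n)"]
      by (intro mult_right_mono) auto
    also have "\<dots> = (real n + 1) / 4" by (simp add: N_def power_divide)
    finally have diff: "p (inner (y (Suc n) - l) (w n)) \<le> (real n + 1) / 4" .
    have "(real n + 1) / 2 \<le> p (inner (y (Suc n)) (w n))" using uw[of n] yw[of n] by linarith
    also have "inner (y (Suc n)) (w n) = inner l (w n) + inner (y (Suc n) - l) (w n)"
      by (simp add: inner_diff_left)
    also have "p \<dots> \<le> p (inner l (w n)) + p (inner (y (Suc n) - l) (w n))" by (rule C.p_add)
    finally have "(real n + 1) / 4 \<le> p (inner l (w n))" using diff by (simp add: field_simps)
    also have "\<dots> \<le> K * f (w n)" by (rule K)
    also have "\<dots> \<le> \<bar>K\<bar> * 1"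
      using w(2)[of n] f_nonneg[of "w n"] by (intro mult_mono) auto
    finally show ?thesis by simp
  qed
  obtain n where "4 * \<bar>K\<bar> < real n" using reals_Archimedean2 by blast
  then show False using growth[of n] by simp
qed

end

section \<open>Closed range from a generalized inverse\<close>

lemma gen_inverse_imp_closed_range:
  assumes X: "hilbert A X" and Y: "hilbert A Y" and T: "T \<in> Hom_star A X Y"
    and Td: "gen_inverse A X Y T Td"
  shows "sn_closed (hm_norms A Y) (range T)"
proof -
  interpret X: hilbert A X by (rule X)
  interpret Y: hilbert A Y by (rule Y)
  have TTT: "T (Td (T x)) = T x" for x using Td by (metis comp_apply gen_inverse_def)
  have T_add: "T (x + y) = T x + T y" for x y using T by (simp add: Hom_star_def module_map_def)
  have Td_add: "Td (x + y) = Td x + Td y" for x y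
    using Td by (simp add: gen_inverse_def Hom_star_def module_map_def)
  show ?thesis
    unfolding sn_closed_def
  proof (intro allI impI)
    fix y assume adh: "\<forall>G. G \<subseteq> hm_norms A Y \<and> finite G \<longrightarrow> (\<forall>e>0. \<exists>c\<in>range T. \<forall>p\<in>G. p (y - c) < e)"
    have "T (Td y) - y = 0"
    proof (rule Y.eq_zero_if_norms_zero)
      fix p assume p: "p \<in> sn A"
      obtain k where k: "\<And>x. Y.nm p (T x) \<le> k * X.nm p x"
        using T p by (auto simp: Hom_star_def bounded_map_def)
      obtain l where l: "\<And>x. X.nm p (Td x) \<le> l * Y.nm p x"
        using Td p by (auto simp: gen_inverse_def Hom_star_def bounded_map_def)
      have kl: "Y.nm p (T (Td x)) \<le> \<bar>k\<bar> * \<bar>l\<bar> * Y.nm p x" for x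
      proof -
        have "Y.nm p (T (Td x)) \<le> \<bar>k\<bar> * X.nm p (Td x)"
          using k[of "Td x"] mult_right_mono[OF abs_ge_self[of k] X.nm_nonneg[OF p, of "Td x"]] by linarith
        also have "X.nm p (Td x) \<le> \<bar>l\<bar> * Y.nm p x"
          using l[of x] mult_right_mono[OF abs_ge_self[of l] Y.nm_nonneg[OF p, of x]] by linarith
        finally show ?thesis by (simp add: mult_left_mono mult.assoc)
      qed
      have "Y.nm p (T (Td y) - y) \<le> 0"
      proof (rule le_of_le_add_mult_eps[where c = "\<bar>k\<bar> * \<bar>l\<bar> + 1"])
        fix e :: real assume e: "0 < e"
        have "{Y.nm p} \<subseteq> hm_norms A Y \<and> finite {Y.nm p}" using p by (auto simp: Y.hm_norms_eq)
        then obtain x where x: "Y.nm p (y - T x) < e"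
          using adh[rule_format, of "{Y.nm p}" e] e by auto
        \<comment> \<open>\<open>T Td\<close> fixes \<open>T x\<close>, so its defect at
          \<open>y\<close> is its defect at the small vector \<open>y - T x\<close>.\<close>
        have "T (Td y) = T (Td (y - T x)) + T x"
          using T_add[of "Td (y - T x)" "Td (T x)"] Td_add[of "y - T x" "T x"] TTT by simp
        then have "T (Td y) - y = T (Td (y - T x)) - (y - T x)" by simp
        then have "Y.nm p (T (Td y) - y) = Y.nm p (T (Td (y - T x)) - (y - T x))" by (simp only:)
        also have "\<dots> \<le> Y.nm p (T (Td (y - T x))) + Y.nm p (y - T x)" by (rule Y.nm_diff[OF p])
        also have "\<dots> \<le> \<bar>k\<bar> * \<bar>l\<bar> * e + e"
          using kl[of "y - T x"] x by (smt (verit) abs_ge_zero mult_left_mono mult_nonneg_nonneg)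
        finally show "Y.nm p (T (Td y) - y) \<le> 0 + (\<bar>k\<bar> * \<bar>l\<bar> + 1) * e" by (simp add: algebra_simps)
      qed simp
      then show "Y.nm p (T (Td y) - y) = 0" using Y.nm_nonneg[OF p, of "T (Td y) - y"] by (rule antisym)
    qed
    then show "y \<in> range T" by (metis eq_iff_diff_eq_0 rangeI)
  qed
qed

section \<open>Ranges, adjoints and bounded maps\<close>

lemma module_map_range_submodule:
  assumes "module_map X Y T"
  shows "submodule Y (range T)"
proof -
  have "T 0 = 0" using assms unfolding module_map_def by (metis add_cancel_right_right)
  then show ?thesis
    using assms unfolding submodule_def module_map_def
    by (auto intro: range_eqI[of _ _ 0]) (metis rangeI)+
qed

lemma (in hilbert) inner_left_cancel: "(\<And>z. inner z x = inner z y) \<Longrightarrow> x = y"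
  using inner_self_zero[of "x - y"] by (simp add: inner_diff_right)

lemma adjoint_sym:
  assumes X: "hilbert A X" and Y: "hilbert A Y" and adj: "is_adjoint X Y T S"
  shows "is_adjoint Y X S T"
proof -
  have "star A (ip Y (T x) y) = star A (ip X x (S y))" for x y using adj by (simp add: is_adjoint_def)
  then show ?thesis
    by (simp add: is_adjoint_def hilbert.star_inner[OF X] hilbert.star_inner[OF Y])
qed

text \<open>\<open>is_adjoint\<close> provides a bare function; its linearity comes from
  nondegeneracy of the inner product.\<close>

lemma adjoint_module_map:
  assumes X: "hilbert A X" and Y: "hilbert A Y" and adj: "is_adjoint X Y T S"
  shows "module_map Y X S"
proof -
  interpret X: hilbert A X by (rule X)
  interpret Y: hilbert A Y by (rule Y)
  have S: "X.inner x (S y) = Y.inner (T x) y" for x y using adj by (simp add: is_adjoint_def)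
  show ?thesis
    unfolding module_map_def
    by (intro conjI allI X.inner_left_cancel)
      (simp_all add: S X.inner_add_right Y.inner_add_right X.inner_sm_right Y.inner_sm_right
        X.inner_act_right Y.inner_act_right)
qed

lemma bounded_mapE:
  assumes "hilbert A X" "bounded_map A X Y T" "p \<in> sn A"
  obtains k where "0 \<le> k" "\<And>x. sqrt (p (ip Y (T x) (T x))) \<le> k * sqrt (p (ip X x x))"
proof -
  interpret X: hilbert A X by (rule assms(1))
  obtain k where k: "\<And>x. sqrt (p (ip Y (T x) (T x))) \<le> k * X.nm p x"
    using assms by (auto simp: bounded_map_def)
  interpret C: cstar_seminormed A p by (rule X.cstar_seminormed[OF assms(3)])
  have "sqrt (p (ip Y (T x) (T x))) \<le> \<bar>k\<bar> * X.nm p x" for x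
    using k[of x] mult_right_mono[OF abs_ge_self[of k], of "X.nm p x"] by simp
  then show ?thesis using that[of "\<bar>k\<bar>"] by simp
qed

lemma bounded_map_comp:
  assumes X: "hilbert A X" and Y: "hilbert A Y"
    and T: "bounded_map A X Y T" and S: "bounded_map A Y Z S"
  shows "bounded_map A X Z (\<lambda>x. S (T x))"
  unfolding bounded_map_def
proof
  fix p assume p: "p \<in> sn A"
  obtain k where k: "0 \<le> k" "\<And>x. sqrt (p (ip Y (T x) (T x))) \<le> k * sqrt (p (ip X x x))"
    using bounded_mapE[OF X T p] by blast
  obtain l where l: "0 \<le> l" "\<And>x. sqrt (p (ip Z (S x) (S x))) \<le> l * sqrt (p (ip Y x x))"
    using bounded_mapE[OF Y S p] by blast
  have "sqrt (p (ip Z (S (T x)) (S (T x)))) \<le> l * k * sqrt (p (ip X x x))" for x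
    using l(2)[of "T x"] mult_left_mono[OF k(2)[of x] l(1)] by (simp only: mult.assoc)
  then show "\<exists>k. \<forall>x. sqrt (p (ip Z (S (T x)) (S (T x)))) \<le> k * sqrt (p (ip X x x))" by blast
qed

lemma adjoint_bounded:
  assumes X: "hilbert A X" and Y: "hilbert A Y" and adj: "is_adjoint X Y T S"
    and T: "bounded_map A X Y T"
  shows "bounded_map A Y X S"
  unfolding bounded_map_def
proof
  fix p assume p: "p \<in> sn A"
  interpret X: hilbert A X by (rule X)
  interpret Y: hilbert A Y by (rule Y)
  obtain k where k: "0 \<le> k" "\<And>x. Y.nm p (T x) \<le> k * X.nm p x"
    using bounded_mapE[OF X T p] by blast
  interpret C: cstar_seminormed A p by (rule X.cstar_seminormed[OF p])
  have "X.nm p (S y) \<le> k * Y.nm p y" for y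
  proof (cases "X.nm p (S y) = 0")
    case True
    then show ?thesis using k(1) by simp
  next
    case False
    then have pos: "0 < X.nm p (S y)" using X.nm_nonneg[OF p, of "S y"] by linarith
    have "X.nm p (S y) * X.nm p (S y) = p (Y.inner (T (S y)) y)"
      using adj X.nm_square[OF p, of "S y"] by (simp add: is_adjoint_def)
    also have "\<dots> \<le> Y.nm p (T (S y)) * Y.nm p y" by (rule Y.cauchy_schwarz[OF p])
    also have "\<dots> \<le> k * X.nm p (S y) * Y.nm p y"
      by (intro mult_right_mono k(2) Y.nm_nonneg[OF p])
    finally have "X.nm p (S y) * X.nm p (S y) \<le> (k * Y.nm p y) * X.nm p (S y)" by (simp only: mult_ac)
    then show ?thesis using pos by (rule mult_right_le_imp_le)
  qed
  then show "\<exists>k. \<forall>y. X.nm p (S y) \<le> k * Y.nm p y" by blast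
qed

section \<open>Construction of the generalized inverse\<close>

lemma closed_range_imp_gen_inverse:
  assumes X: "hilbert A X" and Y: "hilbert A Y" and T: "T \<in> Hom_star A X Y"
    and sub: "submodule Y (range T)" and closed: "sn_closed (hm_norms A Y) (range T)"
  shows "\<exists>Td. gen_inverse A X Y T Td"
proof -
  interpret X: hilbert A X by (rule X)
  interpret Y: hilbert A Y by (rule Y)
  define R where "R = range T"
  note sub = sub[folded R_def] and closed = closed[folded R_def]
  have Tm: "module_map X Y T" and Tb: "bounded_map A X Y T" using T by (auto simp: Hom_star_def)
  obtain S where adj: "is_adjoint X Y T S" using T by (auto simp: Hom_star_def)
  have Sm: "module_map Y X S" by (rule adjoint_module_map[OF X Y adj])
  have Sb: "bounded_map A Y X S" by (rule adjoint_bounded[OF X Y adj Tb])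
  have TS: "Y.inner (T x) y = X.inner x (S y)" for x y using adj by (simp add: is_adjoint_def)
  have ST: "X.inner (S y) x = Y.inner y (T x)" for x y
    using adjoint_sym[OF X Y adj] by (simp add: is_adjoint_def)
  have T_add: "T (x + y) = T x + T y" and T_sm: "T (X.sm c x) = Y.sm c (T x)"
    and T_act: "T (act X a x) = act Y a (T x)" for x y c a using Tm by (simp_all add: module_map_def)
  have S_add: "S (x + y) = S x + S y" and S_sm: "S (Y.sm c x) = X.sm c (S x)"
    and S_act: "S (act Y a x) = act X a (S x)" for x y c a using Sm by (simp_all add: module_map_def)
  define D where "D y = T (S y)" for y
  have D_add: "D (x + y) = D x + D y" and D_sm: "D (Y.sm c x) = Y.sm c (D x)"
    and D_act: "D (act Y a x) = act Y a (D x)" for x y c a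
    by (simp_all add: D_def T_add S_add T_sm S_sm T_act S_act)
  have D_diff: "D (x - y) = D x - D y" for x y using D_add[of "x - y" y] by (simp add: eq_diff_eq)
  have DR: "D y \<in> R" for y by (simp add: D_def R_def)
  have Dsa: "Y.inner (D x) y = Y.inner x (D y)" for x y by (simp add: D_def TS ST)
  have Dpos: "positive A (Y.inner (D y) y)" for y unfolding D_def TS by (rule X.inner_self_positive)
  have Db: "bounded_map A Y Y D" unfolding D_def by (rule bounded_map_comp[OF Y X Sb Tb])
  have below: "\<exists>d>0. \<forall>y\<in>R. d * Y.nm p y \<le> Y.nm p (D y)" if p: "p \<in> sn A" for p
  proof -
    interpret C: cstar_seminormed A p by (rule Y.cstar_seminormed[OF p])
    \<comment> \<open>For \<open>y = T x\<close>, Cauchy--Schwarz bounds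
      \<open>p (inner y w)\<close> by \<open>nm p x * nm p (S w)\<close>: a pointwise bound, with a
      constant depending on \<open>x\<close>.\<close>
    have "\<exists>d>0. \<forall>w\<in>R. d * Y.nm p w \<le> X.nm p (S w)"
    proof (rule Y.uniform_lower_bound[OF sub closed p])
      show "0 \<le> X.nm p (S w)" for w by simp
      show "X.nm p (S (Y.sm (of_real r) w)) = r * X.nm p (S w)" if "0 \<le> r" for r w
        unfolding S_sm X.nm_sm[OF p] using that by simp
      fix y assume "y \<in> R"
      then obtain x where x: "y = T x" by (auto simp: R_def)
      have "p (Y.inner y w) \<le> X.nm p x * X.nm p (S w)" for w
        unfolding x TS by (rule X.cauchy_schwarz[OF p])
      then show "\<exists>C. \<forall>w. p (Y.inner y w) \<le> C * X.nm p (S w)" by blast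
    qed
    then obtain d where d: "0 < d" "\<And>w. w \<in> R \<Longrightarrow> d * Y.nm p w \<le> X.nm p (S w)" by blast
    have "d\<^sup>2 * Y.nm p w \<le> Y.nm p (D w)" if w: "w \<in> R" for w
    proof (cases "Y.nm p w = 0")
      case True
      then show ?thesis by simp
    next
      case False
      then have pos: "0 < Y.nm p w" using Y.nm_nonneg[OF p, of w] by linarith
      have "(d * Y.nm p w)\<^sup>2 \<le> (X.nm p (S w))\<^sup>2"
        using d(1) by (intro power_mono d(2) w) simp
      also have "\<dots> = p (Y.inner (D w) w)" unfolding D_def TS by simp
      also have "\<dots> \<le> Y.nm p (D w) * Y.nm p w" by (rule Y.cauchy_schwarz[OF p])
      finally have "(d\<^sup>2 * Y.nm p w) * Y.nm p w \<le> Y.nm p (D w) * Y.nm p w"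
        by (simp only: power2_eq_square mult_ac)
      then show ?thesis using pos by (rule mult_right_le_imp_le)
    qed
    then show ?thesis using d(1) by (intro exI[of _ "d\<^sup>2"]) auto
  qed
  have D_inj: "u = v" if "u \<in> R" "v \<in> R" "D u = D v" for u v
  proof -
    have "u - v = 0"
    proof (rule Y.eq_zero_if_norms_zero)
      fix p assume p: "p \<in> sn A"
      obtain d where d: "0 < d" "\<And>y. y \<in> R \<Longrightarrow> d * Y.nm p y \<le> Y.nm p (D y)" using below[OF p] by blast
      have "D (u - v) = 0" using that(3) by (simp add: D_diff)
      moreover have "Y.nm p 0 = 0" using Y.nm_sm[OF p, of 0 0] by simp
      ultimately have "d * Y.nm p (u - v) \<le> 0" using d(2)[OF Y.submodule_diff[OF sub that(1,2)]] by simp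
      then have "Y.nm p (u - v) \<le> 0" using d(1) by (simp add: mult_le_0_iff)
      then show "Y.nm p (u - v) = 0" using Y.nm_nonneg[OF p, of "u - v"] by (rule antisym)
    qed
    then show ?thesis by simp
  qed
  have "\<exists>u\<in>R. D u = z" if z: "z \<in> R" for z
  proof -
    have "\<exists>u\<in>R. Y.sm (of_real 0) u + D u = z"
    proof (rule Y.surjective_on_closed_submodule[OF sub closed D_add D_sm DR Dsa Dpos _ _ _ z])
      show "\<exists>K. \<forall>x. Y.nm p (D x) \<le> K * Y.nm p x" if "p \<in> sn A" for p
        using Db that by (simp add: bounded_map_def)
      show "\<exists>d>0. \<forall>x\<in>R. d * Y.nm p x \<le> Y.nm p (Y.sm (of_real 0) x + D x)" if "p \<in> sn A" for p
        using below[OF that] by simp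
    qed simp
    then show ?thesis by simp
  qed
  \<comment> \<open>\<open>G\<close> is arbitrary outside \<open>R\<close>, hence the membership
    conditions in all its rules.\<close>
  then obtain G where G: "\<And>z. z \<in> R \<Longrightarrow> G z \<in> R" "\<And>z. z \<in> R \<Longrightarrow> D (G z) = z" by metis
  have GD: "G (D u) = u" if "u \<in> R" for u using D_inj[OF G(1)[OF DR] that G(2)[OF DR]] .
  have G_eq: "G z = u" if "u \<in> R" "D u = z" for u z using GD[OF that(1)] that(2) by simp
  have R_add: "x + y \<in> R" and R_sm: "Y.sm c x \<in> R" and R_act: "act Y a x \<in> R"
    if "x \<in> R" "y \<in> R" for x y c a using sub that by (auto simp: submodule_def)
  have G_add: "G (x + y) = G x + G y" if "x \<in> R" "y \<in> R" for x y
    using that by (intro G_eq R_add G(1)) (simp_all add: D_add G(2))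
  have G_sm: "G (Y.sm c x) = Y.sm c (G x)" if "x \<in> R" for c x
    using that by (intro G_eq R_sm[OF G(1) G(1)]) (simp_all add: D_sm G(2))
  have G_act: "G (act Y a x) = act Y a (G x)" if "x \<in> R" for a x
    using that by (intro G_eq R_act[OF G(1) G(1)]) (simp_all add: D_act G(2))
  have G_sa: "Y.inner (G x) y = Y.inner x (G y)" if "x \<in> R" "y \<in> R" for x y
    using Dsa[of "G x" "G y"] that by (simp add: G(2))
  \<comment> \<open>The orthogonal projection onto \<open>R\<close>: \<open>D\<close> kills
    \<open>P y - y\<close>, hence so does \<open>S\<close>, and this makes \<open>P y - y\<close>
    orthogonal to every \<open>T x\<close>.\<close>
  define P where "P y = G (D y)" for y
  have PR: "P y \<in> R" for y by (simp add: P_def G(1) DR)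
  have P_id: "P y = y" if "y \<in> R" for y using that by (simp add: P_def GD)
  have SP: "S (P y) = S y" for y
  proof -
    define v where "v = P y - y"
    have "D v = 0" by (simp add: v_def D_diff P_def G(2) DR)
    then have "X.inner (S v) (S v) = 0" using TS[of "S v" v] by (simp add: D_def)
    then have "S v = 0" by (rule X.inner_self_zero)
    then show ?thesis using S_add[of v y] by (simp add: v_def)
  qed
  have P_left: "Y.inner x (P y) = Y.inner x y" if "x \<in> R" for x y
    using that by (auto simp: R_def TS SP)
  have P_right: "Y.inner (P x) y = Y.inner x y" if "y \<in> R" for x y
    using P_left[OF that, of x] by (metis Y.star_inner)
  \<comment> \<open>From \<open>T S = D\<close> it follows that \<open>T Td = D G P = P\<close>; and
    \<open>P T = T\<close> gives \<open>Td T = S G T\<close>.\<close>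
  define Td where "Td y = S (G (P y))" for y
  have TTd: "T (Td y) = P y" for y using G(2)[OF PR[of y]] by (simp add: Td_def D_def)
  have TR: "T x \<in> R" for x by (simp add: R_def)
  have "module_map Y X Td"
    unfolding module_map_def Td_def P_def
    by (simp add: D_add D_sm D_act G_add G_sm G_act G(1) DR S_add S_sm S_act)
  moreover have "bounded_map A Y X Td"
    unfolding bounded_map_def
  proof
    fix p assume p: "p \<in> sn A"
    interpret C: cstar_seminormed A p by (rule Y.cstar_seminormed[OF p])
    obtain d where d: "0 < d" "\<And>y. y \<in> R \<Longrightarrow> d * Y.nm p y \<le> Y.nm p (D y)" using below[OF p] by blast
    obtain k where k: "0 \<le> k" "\<And>y. X.nm p (S y) \<le> k * Y.nm p y" using bounded_mapE[OF Y Sb p] by blast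
    obtain l where l: "0 \<le> l" "\<And>y. Y.nm p (D y) \<le> l * Y.nm p y" using bounded_mapE[OF Y Db p] by blast
    have Gb: "Y.nm p (G z) \<le> Y.nm p z / d" if "z \<in> R" for z
      using d(2)[OF G(1)[OF that]] d(1) unfolding G(2)[OF that] by (simp only: pos_le_divide_eq mult.commute)
    have "X.nm p (Td y) \<le> k * (l / d / d) * Y.nm p y" for y
    proof -
      have "X.nm p (Td y) \<le> k * Y.nm p (G (P y))" unfolding Td_def by (rule k(2))
      also have "\<dots> \<le> k * (l * Y.nm p y / d / d)"
      proof (intro mult_left_mono k(1))
        have "Y.nm p (G (P y)) \<le> Y.nm p (P y) / d" by (rule Gb[OF PR])
        also have "\<dots> \<le> Y.nm p (D y) / d / d"
          unfolding P_def using d(1) by (intro divide_right_mono Gb DR) simp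
        also have "\<dots> \<le> l * Y.nm p y / d / d"
          using d(1) by (intro divide_right_mono l(2)) simp_all
        finally show "Y.nm p (G (P y)) \<le> l * Y.nm p y / d / d" .
      qed
      finally show ?thesis by (simp only: times_divide_eq_left times_divide_eq_right mult.assoc)
    qed
    then show "\<exists>k. \<forall>y. X.nm p (Td y) \<le> k * Y.nm p y" by blast
  qed
  \<comment> \<open>The witness arises by moving \<open>S\<close>, \<open>G\<close> and
    \<open>P\<close> across the inner product in turn; \<open>P\<close> disappears against
    \<open>G (T x)\<close>, which lies in \<open>R\<close>.\<close>
  moreover have "is_adjoint Y X Td (\<lambda>x. G (T x))"
    unfolding is_adjoint_def Td_def
    by (simp add: ST G_sa[OF PR TR] P_right[OF G(1)[OF TR]])
  moreover have "T \<circ> Td \<circ> T = T" by (simp add: fun_eq_iff TTd P_id TR)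
  moreover have "Td \<circ> T \<circ> Td = Td" by (simp add: fun_eq_iff TTd) (simp add: Td_def P_id PR)
  moreover have "is_adjoint Y Y (T \<circ> Td) (T \<circ> Td)"
    using P_left[OF PR] P_right[OF PR] by (simp add: is_adjoint_def TTd)
  moreover have "is_adjoint X X (Td \<circ> T) (Td \<circ> T)"
    by (simp add: is_adjoint_def Td_def P_id TR ST G_sa flip: TS)
  ultimately show ?thesis unfolding gen_inverse_def Hom_star_def by blast
qed

theorem theorem2p3:
  fixes A :: "'a::ring pro_alg"
    and X :: "('a, 'x::ab_group_add) hmod"
    and Y :: "('a, 'y::ab_group_add) hmod"
    and T :: "'x \<Rightarrow> 'y"
  assumes "pro_cstar_algebra A"
    and "hilbert_module A X"
    and "hilbert_module A Y"
    and "T \<in> Hom_star A X Y"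
  shows "(\<exists>Td. gen_inverse A X Y T Td) \<longleftrightarrow>
         (submodule Y (range T) \<and> sn_closed (hm_norms A Y) (range T))"
proof -
  have X: "hilbert A X" and Y: "hilbert A Y" using assms by (simp_all add: hilbert_def)
  have "submodule Y (range T)" using assms(4) by (auto simp: Hom_star_def intro: module_map_range_submodule)
  then show ?thesis
    using gen_inverse_imp_closed_range[OF X Y assms(4)] closed_range_imp_gen_inverse[OF X Y assms(4)] by blast
qed

end
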